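(* Let $(\mathcal S,\mathcal F,\mathcal X,\mathcal A,\mathcal B,\tau,\mathcal C)$ be a logical Algebraic Type System (ATS) with rule set $\mathcal R$ such that every rule of $\mathcal R$ is well-typed. Then it is a Reduction Type System (RTS), i.e. its reduction relation $\to\;=\;\to_{\mathcal R}\cup\to_\beta$ preserves typing: whenever $\Gamma\vdash t:T$ and $t\to t'$, then $\Gamma\vdash t':T$.
   Context: A Type System Modulo (TSM) consists of: a set $\mathcal S$ of sorts; pairwise disjoint sets $\mathcal F^s_n$ ($s\in\mathcal S$, $n\ge0$) of symbols (a symbol of $\mathcal F^s_n$ has sort $s$ and arity $n$); pairwise disjoint countably infinite sets $\mathcal X^s$ of variables of sort $s$ (all these sets disjoint); axioms $\mathcal A\subseteq\mathcal S^2$; product rules $\mathcal B\subseteq\mathcal S^3$; a conversion relation $\mathcal C$ on terms; and a type assignment $\tau$ sending each symbol $f$ of arity $n$ to a closed term $\tau_f=(x_1:T_1)\dots(x_n:T_n)U$. Terms are: sorts, variables, products $(x:t)u$, abstractions $[x:t]u$, applications $tu$, and $f(t_1,\dots,t_n)$ with $f$ of arity $n$; $(x:t)$ and $[x:t]$ bind $x$; terms are considered modulo renaming of bound variables (by variables of the same sort); $\mathrm{FV}(t)$ is the set of free variables and $t\{x\mapsto u\}$ is capture-avoiding substitution. An environment is a list $x_1:T_1,\dots,x_n:T_n$; $\mathrm{dom}(\Gamma)=\{x_1,\dots,x_n\}$, $x_i\Gamma=T_i$. The typing relation is the least relation closed under: (ax) $\vdash s_1:s_2$ (empty environment) if $(s_1,s_2)\in\mathcal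 A$; (symb) if $f\in\mathcal F^s_n$, $\tau_f=(x_1:T_1)\dots(x_n:T_n)U$, $\gamma=\{x_i\mapsto t_i\}$, $\vdash\tau_f:s$, $\Gamma$ valid and $\Gamma\vdash t_i:T_i\gamma$ for all $i$, then $\Gamma\vdash f(t_1,\dots,t_n):U\gamma$; (var) if $\Gamma\vdash T:s$, $x\in\mathcal X^s\setminus\mathrm{dom}(\Gamma)$, then $\Gamma,x:T\vdash x:T$; (weak) if $\Gamma\vdash t:T$, $\Gamma\vdash U:s$, $x\in\mathcal X^s\setminus\mathrm{dom}(\Gamma)$, then $\Gamma,x:U\vdash t:T$; (prod) if $\Gamma\vdash T:s_1$, $\Gamma,x:T\vdash U:s_2$, $(s_1,s_2,s_3)\in\mathcal B$, then $\Gamma\vdash(x:T)U:s_3$; (abs) if $\Gamma,x:T\vdash u:U$ and $\Gamma\vdash(x:T)U:s$, then $\Gamma\vdash[x:T]u:(x:T)U$; (app) if $\Gamma\vdash t:(x:U)V$ and $\Gamma\vdash u:U$ then $\Gamma\vdash tu:V\{x\mapsto u\}$; (conv) if $\Gamma\vdash t:T$, $\Gamma\vdash T':s'$ and $T\,\mathcal C\,T'$ then $\Gamma\vdash t:T'$. $\Gamma$ is valid if some term is typable in it. A substitution $\theta$ is well-typed from $\Gamma$ to $\Delta$ (valid environments), written $\theta:\Gamma\to\Delta$, if $\Delta\vdash x\theta:(x\Gamma)\theta$ for all $x\in\mathrm{dom}(\Gamma)$. For $\Gamma$ an environment: $T\,\mathcal C_\Gamma\,T'$ iff $T\,\mathcal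 C\,T'$ and there are $t,t',s'$ with $\Gamma\vdash t:T$, $\Gamma\vdash t':T'$, $\Gamma\vdash T':s'$; $T\,\mathbb C_\Gamma\,T'$ iff moreover $\Gamma\vdash T:s$ for some sort $s$; $\mathbb C^*_\Gamma$ is the reflexive–transitive closure of $\mathbb C_\Gamma$. A TSM is logical if $(x:T)U\,\mathbb C^*_\Gamma\,(x':T')U'$ implies $T\,\mathbb C^*_\Gamma\,T'$ and $U\,\mathbb C^*_{\Gamma,x:T}\,U'\{x'\mapsto x\}$. A pre-RTS is a TSM whose $\mathcal C$ is $\downarrow$ (joinability: $T\downarrow T'$ iff $T\to^*V$ and $T'\to^*V$ for some $V$) for some relation $\to$ on terms stable by substitution and by context. An algebraic term is a variable or $f(l_1,\dots,l_n)$ with all $l_i$ algebraic. A rewrite rule is a pair $l\to r$ with $l$ algebraic and not a variable, and $\mathrm{FV}(r)\subseteq\mathrm{FV}(l)$; for a set $\mathcal R$ of rules, $\to_{\mathcal R}$ is the least relation stable by substitution and context containing $\mathcal R$; $\to_\beta$ is the least relation stable by substitution and context containing $([x:U]t)\,u\to_\beta t\{x\mapsto u\}$. An ATS is a pre-RTS whose reduction relation is $\to_{\mathcal R}\cup\to_\beta$ for a set $\mathcal R$ of rewrite rules. A rule $l\to r$ with $l=f(l_1,\dots,l_n)$, $\tau_f=(x_1:T_1)\dots(x_n:T_n)U$, $\gamma=\{x_i\mapsto l_i\}$ is well-typed if there are an environment $\Gamma$ and a substitution $\rho$ such that: (S3) $\Gamma\vdash r:U\gamma\rho$; (S4) for all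 $\Delta,\sigma,T$, if $\Delta\vdash l\sigma:T$ then $\sigma:\Gamma\to\Delta$; (S5) for all $\Delta,\sigma,T$, if $\Delta\vdash l\sigma:T$ then $x\sigma\downarrow x\rho\sigma$ for every variable $x$. *)

theory Defs
  imports "HOL-Library.Countable_Set"
begin

section \<open>Terms modulo renaming of bound variables\<close>

text \<open>
  Terms are represented in locally nameless style: free variables are named, bound ones are de
  Bruijn indices, so that renaming of bound variables is equality. A binder records the sort of
  the variable it binds, because bound variables may be renamed only by variables of the same sort.
  Everything below is phrased with the named binders \<open>Prod\<close> and \<open>Lam\<close> and restricted to the set
  \<open>terms\<close>, which excludes dangling indices and wrong arities.
\<close>

datatype ('s, 'v, 'f) trm =
    Sort 's
  | Var 'v
  | Bound nat
  | RawProd 's "('s, 'v, 'f) trm" "('s, 'v, 'f) trm"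
  | RawLam 's "('s, 'v, 'f) trm" "('s, 'v, 'f) trm"
  | App "('s, 'v, 'f) trm" "('s, 'v, 'f) trm"
  | Symb 'f "('s, 'v, 'f) trm list"

primrec FV :: "('s, 'v, 'f) trm \<Rightarrow> 'v set" where
  "FV (Sort s) = {}"
| "FV (Var x) = {x}"
| "FV (Bound i) = {}"
| "FV (RawProd s t u) = FV t \<union> FV u"
| "FV (RawLam s t u) = FV t \<union> FV u"
| "FV (App t u) = FV t \<union> FV u"
| "FV (Symb f ts) = \<Union> (set (map FV ts))"

text \<open>Simultaneous substitution; it is capture-avoiding when the substituted terms have no
  dangling index.\<close>

primrec subst :: "('v \<Rightarrow> ('s, 'v, 'f) trm) \<Rightarrow> ('s, 'v, 'f) trm \<Rightarrow> ('s, 'v, 'f) trm" where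
  "subst \<sigma> (Sort s) = Sort s"
| "subst \<sigma> (Var x) = \<sigma> x"
| "subst \<sigma> (Bound i) = Bound i"
| "subst \<sigma> (RawProd s t u) = RawProd s (subst \<sigma> t) (subst \<sigma> u)"
| "subst \<sigma> (RawLam s t u) = RawLam s (subst \<sigma> t) (subst \<sigma> u)"
| "subst \<sigma> (App t u) = App (subst \<sigma> t) (subst \<sigma> u)"
| "subst \<sigma> (Symb f ts) = Symb f (map (subst \<sigma>) ts)"

primrec bind_var :: "nat \<Rightarrow> 'v \<Rightarrow> ('s, 'v, 'f) trm \<Rightarrow> ('s, 'v, 'f) trm" where
  "bind_var k x (Sort s) = Sort s"
| "bind_var k x (Var y) = (if y = x then Bound k else Var y)"
| "bind_var k x (Bound i) = Bound i"
| "bind_var k x (RawProd s t u) = RawProd s (bind_var k x t) (bind_var (Suc k) x u)"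
| "bind_var k x (RawLam s t u) = RawLam s (bind_var k x t) (bind_var (Suc k) x u)"
| "bind_var k x (App t u) = App (bind_var k x t) (bind_var k x u)"
| "bind_var k x (Symb f ts) = Symb f (map (bind_var k x) ts)"

definition subst1 :: "('s, 'v, 'f) trm \<Rightarrow> 'v \<Rightarrow> ('s, 'v, 'f) trm \<Rightarrow> ('s, 'v, 'f) trm"
    ("_{_ \<mapsto> _}" [1000, 0, 0] 1000) where
  "t{x \<mapsto> u} = subst (Var(x := u)) t"

definition subst_list :: "'v list \<Rightarrow> ('s, 'v, 'f) trm list \<Rightarrow> 'v \<Rightarrow> ('s, 'v, 'f) trm" where
  "subst_list xs ts x = (case map_of (zip xs ts) x of None \<Rightarrow> Var x | Some t \<Rightarrow> t)"


section \<open>Type Systems Modulo\<close>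

text \<open>The sorts are the elements of the type \<open>'s\<close>, the variables those of \<open>'v\<close>.
  \<open>syms s n\<close> is the set of symbols of sort \<open>s\<close> and arity \<open>n\<close>; it may be empty.\<close>

record ('s, 'v, 'f) tsm =
  vsort :: "'v \<Rightarrow> 's"
  syms :: "'s \<Rightarrow> nat \<Rightarrow> 'f set"
  axs :: "('s \<times> 's) set"
  prod_rules :: "('s \<times> 's \<times> 's) set"
  tau :: "'f \<Rightarrow> ('s, 'v, 'f) trm"
  conv :: "('s, 'v, 'f) trm \<Rightarrow> ('s, 'v, 'f) trm \<Rightarrow> bool"

definition vars :: "('s, 'v, 'f) tsm \<Rightarrow> 's \<Rightarrow> 'v set" where
  "vars M s = {x. vsort M x = s}"

definition Prod ::
    "('s, 'v, 'f) tsm \<Rightarrow> 'v \<Rightarrow> ('s, 'v, 'f) trm \<Rightarrow> ('s, 'v, 'f) trm \<Rightarrow> ('s, 'v, 'f) trm" where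
  "Prod M x t u = RawProd (vsort M x) t (bind_var 0 x u)"

definition Lam ::
    "('s, 'v, 'f) tsm \<Rightarrow> 'v \<Rightarrow> ('s, 'v, 'f) trm \<Rightarrow> ('s, 'v, 'f) trm \<Rightarrow> ('s, 'v, 'f) trm" where
  "Lam M x t u = RawLam (vsort M x) t (bind_var 0 x u)"

inductive_set terms :: "('s, 'v, 'f) tsm \<Rightarrow> ('s, 'v, 'f) trm set" for M where
  "Sort s \<in> terms M"
| "Var x \<in> terms M"
| "t \<in> terms M \<Longrightarrow> u \<in> terms M \<Longrightarrow> Prod M x t u \<in> terms M"
| "t \<in> terms M \<Longrightarrow> u \<in> terms M \<Longrightarrow> Lam M x t u \<in> terms M"
| "t \<in> terms M \<Longrightarrow> u \<in> terms M \<Longrightarrow> App t u \<in> terms M"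
| "f \<in> syms M s n \<Longrightarrow> length ts = n \<Longrightarrow> \<forall>t\<in>set ts. t \<in> terms M \<Longrightarrow> Symb f ts \<in> terms M"

definition substitution :: "('s, 'v, 'f) tsm \<Rightarrow> ('v \<Rightarrow> ('s, 'v, 'f) trm) \<Rightarrow> bool" where
  "substitution M \<sigma> \<longleftrightarrow> finite {x. \<sigma> x \<noteq> Var x} \<and> (\<forall>x. \<sigma> x \<in> terms M)"

fun prods :: "('s, 'v, 'f) tsm \<Rightarrow> ('v \<times> ('s, 'v, 'f) trm) list \<Rightarrow> ('s, 'v, 'f) trm
    \<Rightarrow> ('s, 'v, 'f) trm" where
  "prods M [] U = U"
| "prods M ((x, T) # xTs) U = Prod M x T (prods M xTs U)"

text \<open>\<open>sym_type M f [(x\<^sub>1, T\<^sub>1), \<dots>, (x\<^sub>n, T\<^sub>n)] U\<close> means that the type of \<open>f\<close> is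
  \<open>(x\<^sub>1 : T\<^sub>1) \<dots> (x\<^sub>n : T\<^sub>n) U\<close>. The names are chosen pairwise distinct, so that
  \<open>{x\<^sub>1 \<mapsto> t\<^sub>1, \<dots>, x\<^sub>n \<mapsto> t\<^sub>n}\<close> makes sense.\<close>

definition sym_type :: "('s, 'v, 'f) tsm \<Rightarrow> 'f \<Rightarrow> ('v \<times> ('s, 'v, 'f) trm) list
    \<Rightarrow> ('s, 'v, 'f) trm \<Rightarrow> bool" where
  "sym_type M f xTs U \<longleftrightarrow> tau M f = prods M xTs U \<and> distinct (map fst xTs) \<and>
     snd ` set xTs \<subseteq> terms M \<and> U \<in> terms M"

definition TSM :: "('s, 'v, 'f) tsm \<Rightarrow> bool" where
  "TSM M \<longleftrightarrow>
     (\<forall>s. infinite (vars M s) \<and> countable (vars M s)) \<and>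
     (\<forall>f s n s' n'. f \<in> syms M s n \<and> f \<in> syms M s' n' \<longrightarrow> s = s' \<and> n = n') \<and>
     (\<forall>f s n. f \<in> syms M s n \<longrightarrow>
        FV (tau M f) = {} \<and> (\<exists>xTs U. length xTs = n \<and> sym_type M f xTs U)) \<and>
     (\<forall>t u. conv M t u \<longrightarrow> t \<in> terms M \<and> u \<in> terms M)"


section \<open>Typing\<close>

text \<open>Environments are lists with the most recent declaration first: \<open>\<Gamma>, x : T\<close> is
  \<open>(x, T) # \<Gamma>\<close>.\<close>

type_synonym ('s, 'v, 'f) env = "('v \<times> ('s, 'v, 'f) trm) list"

definition dom_env :: "('s, 'v, 'f) env \<Rightarrow> 'v set" where
  "dom_env \<Gamma> = fst ` set \<Gamma>"

text \<open>In \<open>typ_symb\<close> the validity of \<open>\<Gamma>\<close> is the premise that some \<open>v\<close> has some type \<open>V\<close> in \<open>\<Gamma>\<close>.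
  In \<open>typ_app\<close> the premise \<open>V \<in> terms M\<close> excludes bodies \<open>V\<close> with a dangling index, which would
  be bound by \<open>Prod\<close>.\<close>

inductive typing :: "('s, 'v, 'f) tsm \<Rightarrow> ('s, 'v, 'f) env \<Rightarrow> ('s, 'v, 'f) trm
    \<Rightarrow> ('s, 'v, 'f) trm \<Rightarrow> bool" ("_ \<triangleright> _ \<turnstile> _ \<Colon> _" [51, 51, 51, 51] 50) for M where
  typ_ax: "(s1, s2) \<in> axs M \<Longrightarrow> M \<triangleright> [] \<turnstile> Sort s1 \<Colon> Sort s2"
| typ_symb: "\<lbrakk> f \<in> syms M s n; sym_type M f xTs U; length xTs = n; length ts = n;
     \<gamma> = subst_list (map fst xTs) ts;
     M \<triangleright> [] \<turnstile> tau M f \<Colon> Sort s; M \<triangleright> \<Gamma> \<turnstile> v \<Colon> V;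
     \<forall>i<n. M \<triangleright> \<Gamma> \<turnstile> ts ! i \<Colon> subst \<gamma> (snd (xTs ! i)) \<rbrakk>
   \<Longrightarrow> M \<triangleright> \<Gamma> \<turnstile> Symb f ts \<Colon> subst \<gamma> U"
| typ_var: "\<lbrakk> M \<triangleright> \<Gamma> \<turnstile> T \<Colon> Sort s; x \<in> vars M s - dom_env \<Gamma> \<rbrakk>
   \<Longrightarrow> M \<triangleright> (x, T) # \<Gamma> \<turnstile> Var x \<Colon> T"
| typ_weak: "\<lbrakk> M \<triangleright> \<Gamma> \<turnstile> t \<Colon> T; M \<triangleright> \<Gamma> \<turnstile> U \<Colon> Sort s; x \<in> vars M s - dom_env \<Gamma> \<rbrakk>
   \<Longrightarrow> M \<triangleright> (x, U) # \<Gamma> \<turnstile> t \<Colon> T"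
| typ_prod: "\<lbrakk> M \<triangleright> \<Gamma> \<turnstile> T \<Colon> Sort s1; M \<triangleright> (x, T) # \<Gamma> \<turnstile> U \<Colon> Sort s2;
     (s1, s2, s3) \<in> prod_rules M \<rbrakk>
   \<Longrightarrow> M \<triangleright> \<Gamma> \<turnstile> Prod M x T U \<Colon> Sort s3"
| typ_abs: "\<lbrakk> M \<triangleright> (x, T) # \<Gamma> \<turnstile> u \<Colon> U; M \<triangleright> \<Gamma> \<turnstile> Prod M x T U \<Colon> Sort s \<rbrakk>
   \<Longrightarrow> M \<triangleright> \<Gamma> \<turnstile> Lam M x T u \<Colon> Prod M x T U"
| typ_app: "\<lbrakk> M \<triangleright> \<Gamma> \<turnstile> t \<Colon> Prod M x U V; V \<in> terms M; M \<triangleright> \<Gamma> \<turnstile> u \<Colon> U \<rbrakk>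
   \<Longrightarrow> M \<triangleright> \<Gamma> \<turnstile> App t u \<Colon> V{x \<mapsto> u}"
| typ_conv: "\<lbrakk> M \<triangleright> \<Gamma> \<turnstile> t \<Colon> T; M \<triangleright> \<Gamma> \<turnstile> T' \<Colon> Sort s'; conv M T T' \<rbrakk>
   \<Longrightarrow> M \<triangleright> \<Gamma> \<turnstile> t \<Colon> T'"

definition valid :: "('s, 'v, 'f) tsm \<Rightarrow> ('s, 'v, 'f) env \<Rightarrow> bool" where
  "valid M \<Gamma> \<longleftrightarrow> (\<exists>t T. M \<triangleright> \<Gamma> \<turnstile> t \<Colon> T)"

definition wt_subst :: "('s, 'v, 'f) tsm \<Rightarrow> ('v \<Rightarrow> ('s, 'v, 'f) trm) \<Rightarrow> ('s, 'v, 'f) env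
    \<Rightarrow> ('s, 'v, 'f) env \<Rightarrow> bool" where
  "wt_subst M \<theta> \<Gamma> \<Delta> \<longleftrightarrow> substitution M \<theta> \<and> valid M \<Gamma> \<and> valid M \<Delta> \<and>
     (\<forall>(x, T)\<in>set \<Gamma>. M \<triangleright> \<Delta> \<turnstile> \<theta> x \<Colon> subst \<theta> T)"

definition conv_env :: "('s, 'v, 'f) tsm \<Rightarrow> ('s, 'v, 'f) env \<Rightarrow> ('s, 'v, 'f) trm
    \<Rightarrow> ('s, 'v, 'f) trm \<Rightarrow> bool" where
  "conv_env M \<Gamma> T T' \<longleftrightarrow> conv M T T' \<and>
     (\<exists>t t' s'. M \<triangleright> \<Gamma> \<turnstile> t \<Colon> T \<and> M \<triangleright> \<Gamma> \<turnstile> t' \<Colon> T' \<and> M \<triangleright> \<Gamma> \<turnstile> T' \<Colon> Sort s')"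

definition sorted_conv_env :: "('s, 'v, 'f) tsm \<Rightarrow> ('s, 'v, 'f) env \<Rightarrow> ('s, 'v, 'f) trm
    \<Rightarrow> ('s, 'v, 'f) trm \<Rightarrow> bool" where
  "sorted_conv_env M \<Gamma> T T' \<longleftrightarrow> conv_env M \<Gamma> T T' \<and> (\<exists>s. M \<triangleright> \<Gamma> \<turnstile> T \<Colon> Sort s)"

text \<open>As usual the bound variable \<open>x\<close> is chosen outside \<open>dom_env \<Gamma>\<close>; otherwise \<open>\<Gamma>, x : T\<close>
  would not be valid.\<close>

definition logical :: "('s, 'v, 'f) tsm \<Rightarrow> bool" where
  "logical M \<longleftrightarrow> (\<forall>\<Gamma> x T U x' T' U'.
     T \<in> terms M \<and> U \<in> terms M \<and> T' \<in> terms M \<and> U' \<in> terms M \<and> x \<notin> dom_env \<Gamma> \<and>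
     (sorted_conv_env M \<Gamma>)\<^sup>*\<^sup>* (Prod M x T U) (Prod M x' T' U') \<longrightarrow>
     (sorted_conv_env M \<Gamma>)\<^sup>*\<^sup>* T T' \<and>
     (sorted_conv_env M ((x, T) # \<Gamma>))\<^sup>*\<^sup>* U (U'{x' \<mapsto> Var x}))"


section \<open>Reduction\<close>

definition stable_subst :: "('s, 'v, 'f) tsm
    \<Rightarrow> (('s, 'v, 'f) trm \<Rightarrow> ('s, 'v, 'f) trm \<Rightarrow> bool) \<Rightarrow> bool" where
  "stable_subst M r \<longleftrightarrow>
     (\<forall>\<sigma> t t'. substitution M \<sigma> \<and> r t t' \<longrightarrow> r (subst \<sigma> t) (subst \<sigma> t'))"

definition stable_ctx :: "('s, 'v, 'f) tsm
    \<Rightarrow> (('s, 'v, 'f) trm \<Rightarrow> ('s, 'v, 'f) trm \<Rightarrow> bool) \<Rightarrow> bool" where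
  "stable_ctx M r \<longleftrightarrow> (\<forall>t t'. r t t' \<longrightarrow>
     (\<forall>x. \<forall>u\<in>terms M.
        r (Prod M x t u) (Prod M x t' u) \<and> r (Prod M x u t) (Prod M x u t') \<and>
        r (Lam M x t u) (Lam M x t' u) \<and> r (Lam M x u t) (Lam M x u t') \<and>
        r (App t u) (App t' u) \<and> r (App u t) (App u t')) \<and>
     (\<forall>f s us vs. f \<in> syms M s (length us + 1 + length vs) \<and> set us \<union> set vs \<subseteq> terms M \<longrightarrow>
        r (Symb f (us @ t # vs)) (Symb f (us @ t' # vs))))"

inductive rew_closure :: "('s, 'v, 'f) tsm
    \<Rightarrow> (('s, 'v, 'f) trm \<Rightarrow> ('s, 'v, 'f) trm \<Rightarrow> bool)
    \<Rightarrow> ('s, 'v, 'f) trm \<Rightarrow> ('s, 'v, 'f) trm \<Rightarrow> bool" for M Q where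
  rew_base: "Q t t' \<Longrightarrow> rew_closure M Q t t'"
| rew_subst: "substitution M \<sigma> \<Longrightarrow> rew_closure M Q t t' \<Longrightarrow>
     rew_closure M Q (subst \<sigma> t) (subst \<sigma> t')"
| rew_prod1: "rew_closure M Q t t' \<Longrightarrow> u \<in> terms M \<Longrightarrow>
     rew_closure M Q (Prod M x t u) (Prod M x t' u)"
| rew_prod2: "rew_closure M Q t t' \<Longrightarrow> u \<in> terms M \<Longrightarrow>
     rew_closure M Q (Prod M x u t) (Prod M x u t')"
| rew_lam1: "rew_closure M Q t t' \<Longrightarrow> u \<in> terms M \<Longrightarrow>
     rew_closure M Q (Lam M x t u) (Lam M x t' u)"
| rew_lam2: "rew_closure M Q t t' \<Longrightarrow> u \<in> terms M \<Longrightarrow>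
     rew_closure M Q (Lam M x u t) (Lam M x u t')"
| rew_app1: "rew_closure M Q t t' \<Longrightarrow> u \<in> terms M \<Longrightarrow>
     rew_closure M Q (App t u) (App t' u)"
| rew_app2: "rew_closure M Q t t' \<Longrightarrow> u \<in> terms M \<Longrightarrow>
     rew_closure M Q (App u t) (App u t')"
| rew_symb: "rew_closure M Q t t' \<Longrightarrow> f \<in> syms M s (length us + 1 + length vs) \<Longrightarrow>
     set us \<union> set vs \<subseteq> terms M \<Longrightarrow>
     rew_closure M Q (Symb f (us @ t # vs)) (Symb f (us @ t' # vs))"

inductive_set algebraic :: "('s, 'v, 'f) tsm \<Rightarrow> ('s, 'v, 'f) trm set" for M where
  "Var x \<in> algebraic M"
| "f \<in> syms M s n \<Longrightarrow> length ls = n \<Longrightarrow> \<forall>l\<in>set ls. l \<in> algebraic M \<Longrightarrow> Symb f ls \<in> algebraic M"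

definition rewrite_rule :: "('s, 'v, 'f) tsm \<Rightarrow> ('s, 'v, 'f) trm \<Rightarrow> ('s, 'v, 'f) trm \<Rightarrow> bool" where
  "rewrite_rule M l r \<longleftrightarrow>
     l \<in> algebraic M \<and> (\<forall>x. l \<noteq> Var x) \<and> r \<in> terms M \<and> FV r \<subseteq> FV l"

inductive beta_rule :: "('s, 'v, 'f) tsm \<Rightarrow> ('s, 'v, 'f) trm \<Rightarrow> ('s, 'v, 'f) trm \<Rightarrow> bool"
  for M where
  "U \<in> terms M \<Longrightarrow> t \<in> terms M \<Longrightarrow> u \<in> terms M \<Longrightarrow>
     beta_rule M (App (Lam M x U t) u) (t{x \<mapsto> u})"

definition red :: "('s, 'v, 'f) tsm \<Rightarrow> (('s, 'v, 'f) trm \<times> ('s, 'v, 'f) trm) set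
    \<Rightarrow> ('s, 'v, 'f) trm \<Rightarrow> ('s, 'v, 'f) trm \<Rightarrow> bool" where
  "red M R t t' \<longleftrightarrow>
     rew_closure M (\<lambda>l r. (l, r) \<in> R) t t' \<or> rew_closure M (beta_rule M) t t'"

definition joinable :: "('s, 'v, 'f) tsm \<Rightarrow> (('s, 'v, 'f) trm \<Rightarrow> ('s, 'v, 'f) trm \<Rightarrow> bool)
    \<Rightarrow> ('s, 'v, 'f) trm \<Rightarrow> ('s, 'v, 'f) trm \<Rightarrow> bool" where
  "joinable M r T T' \<longleftrightarrow> T \<in> terms M \<and> T' \<in> terms M \<and> (\<exists>V. r\<^sup>*\<^sup>* T V \<and> r\<^sup>*\<^sup>* T' V)"

definition pre_RTS :: "('s, 'v, 'f) tsm
    \<Rightarrow> (('s, 'v, 'f) trm \<Rightarrow> ('s, 'v, 'f) trm \<Rightarrow> bool) \<Rightarrow> bool" where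
  "pre_RTS M r \<longleftrightarrow> TSM M \<and> (\<forall>t t'. r t t' \<longrightarrow> t \<in> terms M \<and> t' \<in> terms M) \<and>
     stable_subst M r \<and> stable_ctx M r \<and> conv M = joinable M r"

definition RTS :: "('s, 'v, 'f) tsm
    \<Rightarrow> (('s, 'v, 'f) trm \<Rightarrow> ('s, 'v, 'f) trm \<Rightarrow> bool) \<Rightarrow> bool" where
  "RTS M r \<longleftrightarrow> pre_RTS M r \<and>
     (\<forall>\<Gamma> t T t'. M \<triangleright> \<Gamma> \<turnstile> t \<Colon> T \<and> r t t' \<longrightarrow> M \<triangleright> \<Gamma> \<turnstile> t' \<Colon> T)"

definition ATS :: "('s, 'v, 'f) tsm \<Rightarrow> (('s, 'v, 'f) trm \<times> ('s, 'v, 'f) trm) set \<Rightarrow> bool" where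
  "ATS M R \<longleftrightarrow> (\<forall>(l, r)\<in>R. rewrite_rule M l r) \<and> pre_RTS M (red M R)"

definition wt_rule :: "('s, 'v, 'f) tsm \<Rightarrow> (('s, 'v, 'f) trm \<times> ('s, 'v, 'f) trm) set
    \<Rightarrow> ('s, 'v, 'f) trm \<Rightarrow> ('s, 'v, 'f) trm \<Rightarrow> bool" where
  "wt_rule M R l r \<longleftrightarrow> (\<exists>f ls xTs U \<gamma> \<Gamma> \<rho>.
     l = Symb f ls \<and> sym_type M f xTs U \<and> length xTs = length ls \<and>
     \<gamma> = subst_list (map fst xTs) ls \<and> substitution M \<rho> \<and>
     M \<triangleright> \<Gamma> \<turnstile> r \<Colon> subst \<rho> (subst \<gamma> U) \<and>
     (\<forall>\<Delta> \<sigma> T. substitution M \<sigma> \<and> M \<triangleright> \<Delta> \<turnstile> subst \<sigma> l \<Colon> T \<longrightarrow> wt_subst M \<sigma> \<Gamma> \<Delta>) \<and>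
     (\<forall>\<Delta> \<sigma> T. substitution M \<sigma> \<and> M \<triangleright> \<Delta> \<turnstile> subst \<sigma> l \<Colon> T \<longrightarrow>
        (\<forall>x. joinable M (red M R) (\<sigma> x) (subst \<sigma> (\<rho> x)))))"


section \<open>Adequacy of the encoding\<close>

lemma FV_bind_var: "FV (bind_var k x u) = FV u - {x}"
  by (induction u arbitrary: k) auto

lemma FV_Prod: "FV (Prod M x t u) = FV t \<union> (FV u - {x})"
  and FV_Lam: "FV (Lam M x t u) = FV t \<union> (FV u - {x})"
  by (simp_all add: Prod_def Lam_def FV_bind_var)

lemma bind_var_rename: "y \<notin> FV u \<Longrightarrow> bind_var k y (u{x \<mapsto> Var y}) = bind_var k x u"
  by (induction u arbitrary: k) (auto simp: subst1_def)

lemma bind_var_fresh: "x \<notin> FV u \<Longrightarrow> bind_var k x u = u"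
  by (induction u arbitrary: k) (auto intro!: map_idI)

lemma subst_bind_var:
  assumes "\<sigma> x = Var x" and "\<And>y. y \<in> FV u - {x} \<Longrightarrow> x \<notin> FV (\<sigma> y)"
  shows "subst \<sigma> (bind_var k x u) = bind_var k x (subst \<sigma> u)"
  using assms
proof (induction u arbitrary: k)
  case (Symb f ts)
  then show ?case by fastforce
qed (auto simp: bind_var_fresh)

lemma subst_Prod:
  assumes "\<sigma> x = Var x" and "\<And>y. y \<in> FV u - {x} \<Longrightarrow> x \<notin> FV (\<sigma> y)"
  shows "subst \<sigma> (Prod M x t u) = Prod M x (subst \<sigma> t) (subst \<sigma> u)"
    and "subst \<sigma> (Lam M x t u) = Lam M x (subst \<sigma> t) (subst \<sigma> u)"
  using subst_bind_var[of \<sigma> x u, OF assms] by (simp_all add: Prod_def Lam_def)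

primrec lc_at :: "nat \<Rightarrow> ('s, 'v, 'f) trm \<Rightarrow> bool" where
  "lc_at k (Sort s) = True"
| "lc_at k (Var y) = True"
| "lc_at k (Bound i) = (i < k)"
| "lc_at k (RawProd s t u) = (lc_at k t \<and> lc_at (Suc k) u)"
| "lc_at k (RawLam s t u) = (lc_at k t \<and> lc_at (Suc k) u)"
| "lc_at k (App t u) = (lc_at k t \<and> lc_at k u)"
| "lc_at k (Symb f ts) = list_all (lc_at k) ts"

lemma lc_at_bind_var: "lc_at k u \<Longrightarrow> lc_at (Suc k) (bind_var k x u)"
  by (induction u arbitrary: k) (auto simp: list_all_iff)

lemma terms_lc: "t \<in> terms M \<Longrightarrow> lc_at 0 t"
  by (induction rule: terms.induct)
    (auto simp: Prod_def Lam_def list_all_iff lc_at_bind_var)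

lemma bind_var_inj:
  "bind_var k x u = bind_var k y u' \<Longrightarrow> lc_at k u \<Longrightarrow> lc_at k u' \<Longrightarrow> u' = u{x \<mapsto> Var y}"
proof (induction u arbitrary: k u')
  case (Symb f ts)
  then obtain ts' where u': "u' = Symb f ts'" and m: "map (bind_var k x) ts = map (bind_var k y) ts'"
    by (cases u') (auto split: if_splits)
  have "length ts = length ts'"
    using m by (metis length_map)
  moreover have "ts' ! i = subst (Var(x := Var y)) (ts ! i)" if "i < length ts" for i
  proof -
    have "bind_var k x (ts ! i) = bind_var k y (ts' ! i)"
      using m that calculation by (metis nth_map)
    then show ?thesis
      using Symb that u' calculation by (simp add: list_all_length subst1_def)
  qed
  ultimately show ?case
    by (auto simp: u' subst1_def intro!: nth_equalityI)
next
  case (RawProd s t u)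
  then show ?case by (cases u') (auto simp: subst1_def split: if_splits)
next
  case (RawLam s t u)
  then show ?case by (cases u') (auto simp: subst1_def split: if_splits)
next
  case (App t u)
  then show ?case by (cases u') (auto simp: subst1_def split: if_splits)
next
  case (Sort s)
  then show ?case by (cases u') (auto simp: subst1_def split: if_splits)
next
  case (Var z)
  then show ?case by (cases u') (auto simp: subst1_def split: if_splits)
next
  case (Bound i)
  then show ?case by (cases u') (auto simp: subst1_def split: if_splits)
qed

text \<open>Equality of products of terms is renaming of the bound variable within its sort.\<close>

lemma Prod_eq_iff:
  assumes "u \<in> terms M" "u' \<in> terms M"
  shows "Prod M x t u = Prod M y t' u' \<longleftrightarrow>
    t = t' \<and> vsort M x = vsort M y \<and> y \<notin> FV u - {x} \<and> u' = u{x \<mapsto> Var y}"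
proof
  assume eq: "Prod M x t u = Prod M y t' u'"
  have "FV u - {x} = FV u' - {y}"
    using eq by (metis FV_bind_var Prod_def trm.inject(4))
  then show "t = t' \<and> vsort M x = vsort M y \<and> y \<notin> FV u - {x} \<and> u' = u{x \<mapsto> Var y}"
    using eq assms by (auto simp: Prod_def intro: bind_var_inj terms_lc)
next
  assume *: "t = t' \<and> vsort M x = vsort M y \<and> y \<notin> FV u - {x} \<and> u' = u{x \<mapsto> Var y}"
  have "u{x \<mapsto> Var x} = u"
    unfolding subst1_def by (induction u) (auto intro: map_idI)
  then show "Prod M x t u = Prod M y t' u'"
    using * by (cases "x = y") (auto simp: Prod_def bind_var_rename)
qed

lemma rew_closure_least:
  shows "stable_subst M (rew_closure M Q)" and "stable_ctx M (rew_closure M Q)"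
    and "Q \<le> rew_closure M Q"
    and "stable_subst M r \<Longrightarrow> stable_ctx M r \<Longrightarrow> Q \<le> r \<Longrightarrow> rew_closure M Q \<le> r"
proof -
  show "stable_subst M (rew_closure M Q)" "stable_ctx M (rew_closure M Q)" "Q \<le> rew_closure M Q"
    unfolding stable_subst_def stable_ctx_def by (auto intro: rew_closure.intros)
  assume r: "stable_subst M r" "stable_ctx M r" "Q \<le> r"
  have "r t t'" if "rew_closure M Q t t'" for t t'
    using that
  proof (induction rule: rew_closure.induct)
    case (rew_subst \<sigma> t t')
    then show ?case using r(1) unfolding stable_subst_def by blast
  qed (use r(2,3) in \<open>unfold stable_ctx_def, blast+\<close>)
  then show "rew_closure M Q \<le> r" by blast
qed

end

theory Submission
  imports Defs
begin

text \<open>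
  Subject reduction is proved together with its counterpart for environments, that typing survives a
  reduction step in a declared type, by induction on typing derivations. A step inside a
  subterm changes the expected type only up to conversion, which the rule (conv) repairs because
  types of typable terms are themselves typable or sorts. A \<open>\<beta>\<close>-step is typed by inverting the
  typing of the abstraction, whose type is linked to the expected product by a chain of conversions
  between typable terms; being logical splits this chain into one for the domains and one for the
  codomains. For a rule \<open>l \<rightarrow> r\<close> and an instance \<open>l\<sigma>\<close>, (S4) makes \<open>\<sigma>\<close> well-typed, so that
  \<open>r\<sigma>\<close> has type \<open>U\<gamma>\<rho>\<sigma>\<close>, which by (S5) is joinable with the type \<open>U\<gamma>\<sigma>\<close> of \<open>l\<sigma>\<close>.
\<close>

section \<open>Substitution and opening of raw terms\<close>

text \<open>Joinability need not be transitive, so a chain of conversions cannot be contracted into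
  one. Each link has to be replayed by (conv), which demands a sort for the type it arrives at;
  hence chains are made of \<open>sorted_conv_env\<close>, which has sorts at both ends and can be
  followed either way, and products are compared only through \<open>logical\<close>. The
  environment half is forced by binders: a step in the domain of a product or abstraction changes
  the declaration under which its body is typed. The remaining obstacle is names.
  \<open>Prod M x t u\<close> determines neither \<open>x\<close> nor \<open>u\<close>, a derivation
  may use another name than the one at hand, and a substitution crosses a binder only with a fresh
  name of the same sort. So typings are inverted on raw bodies, opened at any name of the right sort
  outside the environment, and reduction steps are inverted with the name that the typing rule
  uses.\<close>

lemma subst_Var [simp]: "subst Var t = t"
  by (induction t) (auto intro: map_idI)

lemma subst_subst: "subst \<sigma> (subst \<rho> t) = subst (\<lambda>x. subst \<sigma> (\<rho> x)) t"
  by (induction t) auto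

lemma subst_cong_FV: "(\<And>x. x \<in> FV t \<Longrightarrow> \<sigma> x = \<rho> x) \<Longrightarrow> subst \<sigma> t = subst \<rho> t"
  by (induction t) auto

lemma subst_fresh: "x \<notin> FV t \<Longrightarrow> subst (Var(x := u)) t = t"
  using subst_cong_FV[of t "Var(x := u)" Var] by fastforce

lemma FV_subst: "FV (subst \<sigma> t) = (\<Union>x\<in>FV t. FV (\<sigma> x))"
  by (induction t) auto

lemma finite_FV [simp]: "finite (FV t)"
  by (induction t) auto

text \<open>Unlike in \<open>subst_bind_var\<close>, \<sigma> may move \<open>x\<close>: the binder
  is renamed to \<open>y\<close> on the way, so a substitution can cross any binder once a fresh
  name is taken.\<close>

lemma subst_bind_var_fresh:
  assumes "\<And>z. z \<in> FV u - {x} \<Longrightarrow> y \<notin> FV (\<sigma> z)"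
  shows "subst \<sigma> (bind_var k x u) = bind_var k y (subst (\<sigma>(x := Var y)) u)"
  using assms
proof (induction u arbitrary: k)
  case (Symb f ts)
  have "subst \<sigma> (bind_var k x t) = bind_var k y (subst (\<sigma>(x := Var y)) t)" if "t \<in> set ts" for t
    by (rule Symb.IH[OF that]) (use Symb.prems that in auto)
  then show ?case by (simp del: fun_upd_apply)
qed (auto simp: bind_var_fresh)

lemma subst_Prod_fresh:
  assumes "\<And>z. z \<in> FV u - {x} \<Longrightarrow> y \<notin> FV (\<sigma> z)" and "vsort M y = vsort M x"
  shows "subst \<sigma> (Prod M x t u) = Prod M y (subst \<sigma> t) (subst (\<sigma>(x := Var y)) u)"
    and "subst \<sigma> (Lam M x t u) = Lam M y (subst \<sigma> t) (subst (\<sigma>(x := Var y)) u)"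
  using subst_bind_var_fresh[of u x y \<sigma> 0] assms by (simp_all add: Prod_def Lam_def)

lemma Prod_rename:
  assumes "y \<notin> FV u - {x}" and "vsort M y = vsort M x"
  shows "Prod M x t u = Prod M y t (u{x \<mapsto> Var y})"
    and "Lam M x t u = Lam M y t (u{x \<mapsto> Var y})"
  using subst_Prod_fresh[of u x y Var M t] assms by (auto simp: subst1_def)

lemma subst_upd_rename:
  assumes "y \<notin> FV t - {x}"
  shows "subst (\<sigma>(y := u)) (t{x \<mapsto> Var y}) = subst (\<sigma>(x := u)) t"
  unfolding subst1_def subst_subst using assms by (auto intro!: subst_cong_FV)

lemma subst1_rename:
  "y \<notin> FV t - {x} \<Longrightarrow> (t{x \<mapsto> Var y}){y \<mapsto> u} = t{x \<mapsto> u}"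
  using subst_upd_rename[of y t x Var u] by (simp add: subst1_def)

lemma subst_subst1: "subst \<sigma> (t{x \<mapsto> u}) = subst (\<sigma>(x := subst \<sigma> u)) t"
  unfolding subst1_def subst_subst by (auto intro!: subst_cong_FV)

text \<open>Undoes \<open>bind_var\<close> up to the choice of the name. A raw body has no canonical
  bound name, so it is read by filling its index. No index is shifted, so \<open>v\<close> is meant
  to be locally closed.\<close>

primrec open_at :: "nat \<Rightarrow> ('s, 'v, 'f) trm \<Rightarrow> ('s, 'v, 'f) trm \<Rightarrow> ('s, 'v, 'f) trm" where
  "open_at k v (Sort s) = Sort s"
| "open_at k v (Var y) = Var y"
| "open_at k v (Bound i) = (if i = k then v else Bound i)"
| "open_at k v (RawProd s t u) = RawProd s (open_at k v t) (open_at (Suc k) v u)"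
| "open_at k v (RawLam s t u) = RawLam s (open_at k v t) (open_at (Suc k) v u)"
| "open_at k v (App t u) = App (open_at k v t) (open_at k v u)"
| "open_at k v (Symb f ts) = Symb f (map (open_at k v) ts)"

lemma lc_at_mono: "lc_at k t \<Longrightarrow> k \<le> j \<Longrightarrow> lc_at j t"
  by (induction t arbitrary: k j) (auto simp: list_all_iff)

lemma open_at_lc: "lc_at k t \<Longrightarrow> open_at k v t = t"
  by (induction t arbitrary: k) (auto simp: list_all_iff intro: map_idI)

text \<open>The images of \<sigma> have no dangling index, so the only occurrences of index
  \<open>k\<close> after binding are those that replaced \<open>x\<close>.\<close>

lemma open_at_subst_bind_var:
  assumes "lc_at k t" and "\<And>x. lc_at 0 (\<sigma> x)"
  shows "open_at k v (subst \<sigma> (bind_var k x t)) = subst (\<sigma>(x := v)) t"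
  using assms(1)
proof (induction t arbitrary: k)
  case (Var y)
  then show ?case using lc_at_mono[OF assms(2), of k] by (auto intro: open_at_lc)
qed (auto simp: list_all_iff)

lemma open_at_bind_var: "lc_at 0 t \<Longrightarrow> open_at 0 v (bind_var 0 x t) = t{x \<mapsto> v}"
  using open_at_subst_bind_var[of 0 t Var v x] by (simp add: subst1_def)

section \<open>Argument substitutions\<close>

lemma subst_list_nth:
  "distinct xs \<Longrightarrow> length xs = length ts \<Longrightarrow> i < length ts \<Longrightarrow> subst_list xs ts (xs ! i) = ts ! i"
  by (simp add: subst_list_def map_of_zip_nth)

lemma subst_list_map:
  "x \<in> set xs \<Longrightarrow> length xs = length ts \<Longrightarrow>
    subst_list xs (map g ts) x = g (subst_list xs ts x)"
proof (induction xs ts rule: list_induct2')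
  case (4 a xs b ts)
  then show ?case by (auto simp: subst_list_def)
qed auto

text \<open>Iterated updates follow the recursion of a telescope, one argument per product.
  Distinctness matters: \<open>map_of\<close> prefers the first pair with a given name, the fold the
  last.\<close>

lemma subst_list_eq: "distinct xs \<Longrightarrow> length xs = length ts \<Longrightarrow>
    subst_list xs ts = fold (\<lambda>(x, t) \<sigma>. \<sigma>(x := t)) (zip xs ts) Var"
proof (induction xs arbitrary: ts rule: rev_induct)
  case Nil
  then show ?case by (auto simp: subst_list_def)
next
  case (snoc x xs)
  then obtain ts' t where ts: "ts = ts' @ [t]" "length xs = length ts'"
    by (metis length_append_singleton length_Suc_conv_rev)
  have "subst_list (xs @ [x]) (ts' @ [t]) = (subst_list xs ts')(x := t)"
    using snoc.prems ts
    by (auto simp: subst_list_def fun_eq_iff map_add_def split: option.splits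
        dest!: map_of_SomeD set_zip_leftD)
  then show ?case using snoc ts by auto
qed

lemma FV_prods:
  "FV U \<subseteq> FV (prods M xTs U) \<union> fst ` set xTs"
  "(x, T) \<in> set xTs \<Longrightarrow> FV T \<subseteq> FV (prods M xTs U) \<union> fst ` set xTs"
  by (induction xTs) (auto simp: FV_Prod)

lemma prods_terms: "snd ` set xTs \<subseteq> terms M \<Longrightarrow> U \<in> terms M \<Longrightarrow> prods M xTs U \<in> terms M"
  by (induction xTs) (auto intro: terms.intros)

text \<open>Instantiating a telescope does not depend on the names chosen for its variables. Only after a
  substitution do the bodies of two equal products become comparable, hence \<open>\<sigma>\<close> and \<open>\<sigma>'\<close>.\<close>

lemma subst_prods_eq:
  assumes "subst \<sigma> (prods M xTs U) = subst \<sigma>' (prods M xTs' U')"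
    and "length xTs = length ts" "length xTs' = length ts"
    and "snd ` set xTs \<subseteq> terms M" "U \<in> terms M" "snd ` set xTs' \<subseteq> terms M" "U' \<in> terms M"
    and "\<And>x. lc_at 0 (\<sigma> x)" "\<And>x. lc_at 0 (\<sigma>' x)" "\<And>t. t \<in> set ts \<Longrightarrow> lc_at 0 t"
  shows "subst (fold (\<lambda>(x, t) \<sigma>. \<sigma>(x := t)) (zip (map fst xTs) ts) \<sigma>) U
    = subst (fold (\<lambda>(x, t) \<sigma>. \<sigma>(x := t)) (zip (map fst xTs') ts) \<sigma>') U'"
  using assms
proof (induction ts arbitrary: xTs xTs' \<sigma> \<sigma>')
  case Nil
  then show ?case by simp
next
  case (Cons t ts)
  obtain x T ys where xTs: "xTs = (x, T) # ys" using Cons.prems(2) by (cases xTs) auto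
  obtain x' T' ys' where xTs': "xTs' = (x', T') # ys'" using Cons.prems(3) by (cases xTs') auto
  have "subst \<sigma> (bind_var 0 x (prods M ys U)) = subst \<sigma>' (bind_var 0 x' (prods M ys' U'))"
    using Cons.prems(1) by (simp add: xTs xTs' Prod_def)
  moreover have "lc_at 0 (prods M ys U)" "lc_at 0 (prods M ys' U')"
    using Cons.prems xTs xTs' by (auto intro!: terms_lc[of _ M] prods_terms)
  \<comment> \<open>Filling both bodies with the same argument removes the binder, whatever its name
    on either side.\<close>
  ultimately have "subst (\<sigma>(x := t)) (prods M ys U) = subst (\<sigma>'(x' := t)) (prods M ys' U')"
    using open_at_subst_bind_var[of 0 "prods M ys U" \<sigma> t x]
      open_at_subst_bind_var[of 0 "prods M ys' U'" \<sigma>' t x'] Cons.prems by simp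
  moreover have lc: "lc_at 0 ((\<sigma>(x := t)) z)" "lc_at 0 ((\<sigma>'(x' := t)) z)" for z
    using Cons.prems by auto
  ultimately have "subst (fold (\<lambda>(x, t) \<sigma>. \<sigma>(x := t)) (zip (map fst ys) ts) (\<sigma>(x := t))) U
    = subst (fold (\<lambda>(x, t) \<sigma>. \<sigma>(x := t)) (zip (map fst ys') ts) (\<sigma>'(x' := t))) U'"
    using Cons.prems lc unfolding xTs xTs' by (intro Cons.IH) (simp_all del: fun_upd_apply)
  then show ?case by (simp add: xTs xTs' del: fun_upd_apply)
qed

text \<open>Two decompositions of \<open>tau M f\<close> are the same product up to names, and
  instantiation forgets names. This reconciles the telescope of a derivation with the one chosen for
  a rewrite rule.\<close>

lemma sym_type_subst_eq:
  assumes "sym_type M f xTs U" "sym_type M f xTs' U'"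
    and "length xTs = length ts" "length xTs' = length ts" "set ts \<subseteq> terms M"
  shows "subst (subst_list (map fst xTs) ts) U = subst (subst_list (map fst xTs') ts) U'"
  using assms subst_prods_eq[of Var M xTs U Var xTs' U' ts]
  by (auto simp: sym_type_def subst_list_eq intro: terms_lc)

section \<open>Metatheory of pre-reduction type systems\<close>

locale pre_rts =
  fixes M :: "('s, 'v, 'f) tsm" and r :: "('s, 'v, 'f) trm \<Rightarrow> ('s, 'v, 'f) trm \<Rightarrow> bool"
  assumes pre_RTS: "pre_RTS M r"
begin

lemma fresh_var:
  assumes "finite A"
  obtains y where "vsort M y = s" "y \<notin> A"
proof -
  have "infinite (vars M s)" using pre_RTS by (auto simp: pre_RTS_def TSM_def)
  then have "infinite (vars M s - A)" using assms by (rule Diff_infinite_finite[rotated])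
  then have "vars M s - A \<noteq> {}" by (rule infinite_imp_nonempty)
  then show ?thesis using that by (auto simp: vars_def)
qed

text \<open>\<sigma> is arbitrary in the induction, since below a binder it is updated at the bound
  variable, renamed to a \<open>y\<close> that no image of a free variable of the body
  contains.\<close>

lemma subst_in_terms: "t \<in> terms M \<Longrightarrow> (\<And>x. \<sigma> x \<in> terms M) \<Longrightarrow> subst \<sigma> t \<in> terms M"
proof (induction arbitrary: \<sigma> rule: terms.induct)
  case (3 t u x)
  obtain y where "vsort M y = vsort M x" "y \<notin> (\<Union>z\<in>FV u. FV (\<sigma> z))"
    using fresh_var[of "\<Union>z\<in>FV u. FV (\<sigma> z)"] by auto
  moreover have "subst (\<sigma>(x := Var y)) u \<in> terms M"
    using "3.prems" by (intro "3.IH") (auto intro: terms.intros)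
  ultimately show ?case
    using 3 subst_Prod_fresh[of u x y \<sigma> M t] by (auto intro!: terms.intros)
next
  case (4 t u x)
  obtain y where "vsort M y = vsort M x" "y \<notin> (\<Union>z\<in>FV u. FV (\<sigma> z))"
    using fresh_var[of "\<Union>z\<in>FV u. FV (\<sigma> z)"] by auto
  moreover have "subst (\<sigma>(x := Var y)) u \<in> terms M"
    using "4.prems" by (intro "4.IH") (auto intro: terms.intros)
  ultimately show ?case
    using 4 subst_Prod_fresh[of u x y \<sigma> M t] by (auto intro!: terms.intros)
qed (auto intro!: terms.intros)

lemma substitution_Var [simp]: "substitution M Var"
  by (auto simp: substitution_def intro: terms.intros)

lemma substitution_upd: "substitution M \<sigma> \<Longrightarrow> u \<in> terms M \<Longrightarrow> substitution M (\<sigma>(x := u))"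
  unfolding substitution_def
  by (auto intro: finite_subset[of _ "insert x {x. \<sigma> x \<noteq> Var x}"])

lemma substitution_comp:
  assumes "substitution M \<sigma>" "substitution M \<rho>"
  shows "substitution M (\<lambda>x. subst \<sigma> (\<rho> x))"
proof -
  have "{x. subst \<sigma> (\<rho> x) \<noteq> Var x} \<subseteq> {x. \<sigma> x \<noteq> Var x} \<union> {x. \<rho> x \<noteq> Var x}"
  proof
    fix x assume "x \<in> {x. subst \<sigma> (\<rho> x) \<noteq> Var x}"
    then show "x \<in> {x. \<sigma> x \<noteq> Var x} \<union> {x. \<rho> x \<noteq> Var x}" by (cases "\<rho> x = Var x") auto
  qed
  then show ?thesis
    using assms by (auto simp: substitution_def intro: subst_in_terms finite_subset)
qed

lemma substitution_subst_list:
  assumes "set ts \<subseteq> terms M"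
  shows "substitution M (subst_list xs ts)"
proof -
  have "{x. subst_list xs ts x \<noteq> Var x} \<subseteq> set xs"
    by (auto simp: subst_list_def split: option.splits dest!: map_of_SomeD set_zip_leftD)
  moreover have "subst_list xs ts x \<in> terms M" for x
    using assms by (auto simp: subst_list_def split: option.splits
        dest!: map_of_SomeD set_zip_rightD intro: terms.intros)
  ultimately show ?thesis unfolding substitution_def by (auto intro: finite_subset)
qed

lemma substitution_in_terms: "t \<in> terms M \<Longrightarrow> substitution M \<sigma> \<Longrightarrow> subst \<sigma> t \<in> terms M"
  by (simp add: substitution_def subst_in_terms)

subsection \<open>Conversion\<close>

lemma r_in_terms: "r t t' \<Longrightarrow> t \<in> terms M \<and> t' \<in> terms M"
  using pre_RTS by (auto simp: pre_RTS_def)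

lemma rtranclp_r_in_terms: "r\<^sup>*\<^sup>* t t' \<Longrightarrow> t \<in> terms M \<Longrightarrow> t' \<in> terms M"
  by (induction rule: rtranclp_induct) (auto dest: r_in_terms)

lemma r_subst: "substitution M \<sigma> \<Longrightarrow> r t t' \<Longrightarrow> r (subst \<sigma> t) (subst \<sigma> t')"
  using pre_RTS by (auto simp: pre_RTS_def stable_subst_def)

lemma r_ctx:
  assumes "r t t'" "u \<in> terms M"
  shows "r (Prod M x t u) (Prod M x t' u)" "r (Prod M x u t) (Prod M x u t')"
    "r (Lam M x t u) (Lam M x t' u)" "r (Lam M x u t) (Lam M x u t')"
    "r (App t u) (App t' u)" "r (App u t) (App u t')"
  using pre_RTS assms by (auto simp: pre_RTS_def stable_ctx_def)

lemma r_Symb: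
  assumes "r t t'" "f \<in> syms M s (length us + 1 + length vs)" "set us \<union> set vs \<subseteq> terms M"
  shows "r (Symb f (us @ t # vs)) (Symb f (us @ t' # vs))"
  using pre_RTS assms unfolding pre_RTS_def stable_ctx_def by blast

section \<open>Reduction sequences in contexts and substitutions\<close>

lemma rtranclp_lift:
  assumes "r\<^sup>*\<^sup>* t t'" and "\<And>a b. r a b \<Longrightarrow> r (C a) (C b)"
  shows "r\<^sup>*\<^sup>* (C t) (C t')"
  using assms(1) by (induction rule: rtranclp_induct) (auto intro: assms(2) rtranclp.rtrancl_into_rtrancl)

text \<open>The prefix \<open>us\<close> holds the arguments already rewritten, so the induction
  proceeds from left to right while the arity stays that of the whole list.\<close>

lemma rtranclp_Symb:
  assumes "list_all2 r\<^sup>*\<^sup>* ts ts'" "f \<in> syms M s (length us + length ts)"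
    "set us \<subseteq> terms M" "set ts \<subseteq> terms M"
  shows "r\<^sup>*\<^sup>* (Symb f (us @ ts)) (Symb f (us @ ts'))"
  using assms
proof (induction ts ts' arbitrary: us rule: list_all2_induct)
  case Nil
  then show ?case by simp
next
  case (Cons t ts t' ts')
  have "r\<^sup>*\<^sup>* (Symb f (us @ t # ts)) (Symb f (us @ t' # ts))"
    using Cons.hyps(1)
    by (rule rtranclp_lift) (use Cons.prems in \<open>auto intro!: r_Symb\<close>)
  moreover have "t' \<in> terms M"
    using Cons.hyps(1) Cons.prems by (auto intro: rtranclp_r_in_terms)
  then have "r\<^sup>*\<^sup>* (Symb f (us @ t' # ts)) (Symb f (us @ t' # ts'))"
    using Cons.IH[of "us @ [t']"] Cons.prems by simp
  ultimately show ?case by (rule rtranclp_trans)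
qed

text \<open>Every occurrence of a variable is reduced in its own context. Below a binder both
  substitutions are sent to one common fresh \<open>y\<close>, so that the two sides still share
  their bound name.\<close>

lemma rtranclp_subst:
  assumes "t \<in> terms M" "\<And>x. r\<^sup>*\<^sup>* (\<sigma> x) (\<sigma>' x)" "\<And>x. \<sigma> x \<in> terms M"
  shows "r\<^sup>*\<^sup>* (subst \<sigma> t) (subst \<sigma>' t)"
  using assms
proof (induction arbitrary: \<sigma> \<sigma>' rule: terms.induct)
  case (3 t u x)
  have \<sigma>': "\<And>x. \<sigma>' x \<in> terms M" using "3.prems" rtranclp_r_in_terms by blast
  obtain y where y: "vsort M y = vsort M x" "y \<notin> (\<Union>z\<in>FV u. FV (\<sigma> z) \<union> FV (\<sigma>' z))"
    using fresh_var[of "\<Union>z\<in>FV u. FV (\<sigma> z) \<union> FV (\<sigma>' z)"] by auto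
  let ?u = "subst (\<sigma>(x := Var y)) u" and ?u' = "subst (\<sigma>'(x := Var y)) u"
  have "r\<^sup>*\<^sup>* (subst \<sigma> t) (subst \<sigma>' t)" using "3.prems" by (rule "3.IH")
  moreover have "r\<^sup>*\<^sup>* ?u ?u'"
    using "3.prems" by (intro "3.IH") (auto intro: terms.intros)
  moreover have "subst \<sigma>' t \<in> terms M" "?u \<in> terms M"
    using 3 \<sigma>' by (auto intro!: subst_in_terms intro: terms.intros)
  ultimately have "r\<^sup>*\<^sup>* (Prod M y (subst \<sigma> t) ?u) (Prod M y (subst \<sigma>' t) ?u')"
    by (meson rtranclp_trans rtranclp_lift[where C = "\<lambda>t. Prod M y t ?u"]
        rtranclp_lift[where C = "\<lambda>u. Prod M y (subst \<sigma>' t) u"] r_ctx)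
  then show ?case
    using y subst_Prod_fresh[of u x y \<sigma> M t] subst_Prod_fresh[of u x y \<sigma>' M t] by auto
next
  case (4 t u x)
  have \<sigma>': "\<And>x. \<sigma>' x \<in> terms M" using "4.prems" rtranclp_r_in_terms by blast
  obtain y where y: "vsort M y = vsort M x" "y \<notin> (\<Union>z\<in>FV u. FV (\<sigma> z) \<union> FV (\<sigma>' z))"
    using fresh_var[of "\<Union>z\<in>FV u. FV (\<sigma> z) \<union> FV (\<sigma>' z)"] by auto
  let ?u = "subst (\<sigma>(x := Var y)) u" and ?u' = "subst (\<sigma>'(x := Var y)) u"
  have "r\<^sup>*\<^sup>* (subst \<sigma> t) (subst \<sigma>' t)" using "4.prems" by (rule "4.IH")
  moreover have "r\<^sup>*\<^sup>* ?u ?u'"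
    using "4.prems" by (intro "4.IH") (auto intro: terms.intros)
  moreover have "subst \<sigma>' t \<in> terms M" "?u \<in> terms M"
    using 4 \<sigma>' by (auto intro!: subst_in_terms intro: terms.intros)
  ultimately have "r\<^sup>*\<^sup>* (Lam M y (subst \<sigma> t) ?u) (Lam M y (subst \<sigma>' t) ?u')"
    by (meson rtranclp_trans rtranclp_lift[where C = "\<lambda>t. Lam M y t ?u"]
        rtranclp_lift[where C = "\<lambda>u. Lam M y (subst \<sigma>' t) u"] r_ctx)
  then show ?case
    using y subst_Prod_fresh[of u x y \<sigma> M t] subst_Prod_fresh[of u x y \<sigma>' M t] by auto
next
  case (5 t u)
  have \<sigma>': "\<And>x. \<sigma>' x \<in> terms M" using "5.prems" rtranclp_r_in_terms by blast
  have "r\<^sup>*\<^sup>* (subst \<sigma> t) (subst \<sigma>' t)" "r\<^sup>*\<^sup>* (subst \<sigma> u) (subst \<sigma>' u)"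
    using 5 by auto
  moreover have "subst \<sigma>' t \<in> terms M" "subst \<sigma> u \<in> terms M"
    using 5 \<sigma>' by (auto intro!: subst_in_terms)
  ultimately show ?case
    by simp (meson rtranclp_trans rtranclp_lift[where C = "\<lambda>t. App t (subst \<sigma> u)"]
        rtranclp_lift[where C = "\<lambda>u. App (subst \<sigma>' t) u"] r_ctx)
next
  case (6 f s n ts)
  have "list_all2 r\<^sup>*\<^sup>* (map (subst \<sigma>) ts) (map (subst \<sigma>') ts)"
    using 6 by (auto simp: list_all2_conv_all_nth)
  then show ?case
    using 6 rtranclp_Symb[of "map (subst \<sigma>) ts" "map (subst \<sigma>') ts" f s "[]"]
    by (auto intro: subst_in_terms)
qed auto

lemma conv_iff: "conv M t t' \<longleftrightarrow> joinable M r t t'"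
  using pre_RTS by (simp add: pre_RTS_def)

lemma conv_sym: "conv M t t' \<Longrightarrow> conv M t' t"
  by (auto simp: conv_iff joinable_def)

lemma conv_r: "r t t' \<Longrightarrow> conv M t t'"
  by (auto simp: conv_iff joinable_def dest: r_in_terms)

lemma conv_subst:
  assumes "substitution M \<sigma>" "conv M t t'"
  shows "conv M (subst \<sigma> t) (subst \<sigma> t')"
proof -
  obtain v where v: "r\<^sup>*\<^sup>* t v" "r\<^sup>*\<^sup>* t' v" "t \<in> terms M" "t' \<in> terms M"
    using assms(2) by (auto simp: conv_iff joinable_def)
  have "r\<^sup>*\<^sup>* (subst \<sigma> a) (subst \<sigma> b)" if "r\<^sup>*\<^sup>* a b" for a b
    using that by (rule rtranclp_lift) (rule r_subst[OF assms(1)])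
  then show ?thesis
    using v assms(1) by (auto simp: conv_iff joinable_def substitution_def intro: subst_in_terms)
qed

text \<open>Choosing a common reduct of \<open>\<sigma> x\<close> and \<open>\<sigma>' x\<close> for
  each \<open>x\<close> gives a third substitution to which both reduce pointwise. It serves both
  for a reduced argument and for (S5).\<close>

lemma conv_substs:
  assumes "t \<in> terms M" "\<And>x. conv M (\<sigma> x) (\<sigma>' x)"
  shows "conv M (subst \<sigma> t) (subst \<sigma>' t)"
proof -
  have *: "\<sigma> x \<in> terms M \<and> \<sigma>' x \<in> terms M \<and> (\<exists>v. r\<^sup>*\<^sup>* (\<sigma> x) v \<and> r\<^sup>*\<^sup>* (\<sigma>' x) v)" for x
    using assms(2)[of x] by (auto simp: conv_iff joinable_def)
  then obtain \<delta> where "\<And>x. r\<^sup>*\<^sup>* (\<sigma> x) (\<delta> x) \<and> r\<^sup>*\<^sup>* (\<sigma>' x) (\<delta> x)" by metis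
  then show ?thesis
    using * assms(1) unfolding conv_iff joinable_def by (blast intro: rtranclp_subst subst_in_terms)
qed

lemma conv_refl: "t \<in> terms M \<Longrightarrow> conv M t t"
  by (auto simp: conv_iff joinable_def)

lemma conv_subst1:
  assumes "t \<in> terms M" "conv M u u'"
  shows "conv M (t{x \<mapsto> u}) (t{x \<mapsto> u'})"
  unfolding subst1_def using assms by (auto intro!: conv_substs conv_refl terms.intros)

subsection \<open>Basic properties of typing\<close>

lemma tau_closed: "f \<in> syms M s n \<Longrightarrow> FV (tau M f) = {}"
  using pre_RTS unfolding pre_RTS_def TSM_def by blast

lemma typing_in_terms: "M \<triangleright> \<Gamma> \<turnstile> t \<Colon> T \<Longrightarrow> t \<in> terms M \<and> T \<in> terms M"
proof (induction rule: typing.induct)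
  case (typ_symb f s n xTs U ts \<gamma> \<Gamma> v V)
  then have "set ts \<subseteq> terms M" by (auto simp: in_set_conv_nth)
  then show ?case
    using typ_symb substitution_subst_list[of ts "map fst xTs"]
    by (auto simp: sym_type_def substitution_def intro!: terms.intros subst_in_terms)
next
  case (typ_app \<Gamma> t x U V u)
  then show ?case
    by (auto simp: subst1_def intro!: terms.intros subst_in_terms)
next
  case (typ_abs x T \<Gamma> u U s)
  \<comment> \<open>The induction says nothing about the types declared in an environment, so
    \<open>T\<close> is recovered from the product.\<close>
  have "T \<in> terms M"
    using typ_abs.IH(2)[THEN conjunct1] by cases (auto simp: Prod_def Lam_def)
  then show ?case using typ_abs by (auto intro: terms.intros)
qed (auto intro: terms.intros)

lemma FV_subst_list:
  assumes "FV t \<subseteq> set xs" "\<And>u. u \<in> set ts \<Longrightarrow> FV u \<subseteq> A" "length xs = length ts"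
  shows "FV (subst (subst_list xs ts) t) \<subseteq> A"
proof -
  have "FV (subst_list xs ts x) \<subseteq> A" if x: "x \<in> set xs" for x
  proof -
    obtain u where "map_of (zip xs ts) x = Some u"
      using x assms(3) by (metis map_of_zip_is_Some)
    then show ?thesis
      using assms(2) by (auto simp: subst_list_def dest!: map_of_SomeD set_zip_rightD)
  qed
  then show ?thesis using assms(1) by (auto simp: FV_subst)
qed

text \<open>\<open>tau M f\<close> is closed, so the products of the telescope bind everything that
  is free in its parts.\<close>

lemma sym_type_FV:
  assumes "f \<in> syms M s n" "sym_type M f xTs U"
  shows "FV U \<subseteq> fst ` set xTs" "(x, T) \<in> set xTs \<Longrightarrow> FV T \<subseteq> fst ` set xTs"
  using assms FV_prods(1)[of U M xTs] FV_prods(2)[of x T xTs M U] tau_closed[OF assms(1)]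
  by (auto simp: sym_type_def)

lemma typing_FV: "M \<triangleright> \<Gamma> \<turnstile> t \<Colon> T \<Longrightarrow> FV t \<union> FV T \<subseteq> dom_env \<Gamma>"
proof (induction rule: typing.induct)
  case (typ_symb f s n xTs U ts \<gamma> \<Gamma> v V)
  then have *: "FV u \<subseteq> dom_env \<Gamma>" if "u \<in> set ts" for u
    using that by (auto simp: in_set_conv_nth)
  moreover have "FV (subst \<gamma> U) \<subseteq> dom_env \<Gamma>"
    unfolding \<open>\<gamma> = _\<close>
    by (rule FV_subst_list) (use typ_symb * sym_type_FV in auto)
  ultimately show ?case by auto
next
  case (typ_app \<Gamma> t x U V u)
  then show ?case by (auto simp: subst1_def FV_subst FV_Prod split: if_splits)
qed (auto simp: dom_env_def FV_Prod FV_Lam)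

text \<open>The last declaration is only ever added by (var) or (weak), whose premises contain the
  conclusion. Every other rule that applies has a premise in the same environment; for (symb)
  without arguments it is the one stating validity.\<close>

lemma typing_env_ConsD:
  assumes "M \<triangleright> (x, U) # \<Gamma> \<turnstile> t \<Colon> T"
  shows "\<exists>s. M \<triangleright> \<Gamma> \<turnstile> U \<Colon> Sort s \<and> x \<in> vars M s - dom_env \<Gamma>"
  using assms by (induction "(x, U) # \<Gamma>" t T arbitrary: x U \<Gamma> rule: typing.induct) auto

lemma valid_ConsD:
  assumes "valid M ((x, U) # \<Gamma>)"
  obtains s where "M \<triangleright> \<Gamma> \<turnstile> U \<Colon> Sort s" "vsort M x = s" "x \<notin> dom_env \<Gamma>" "valid M \<Gamma>"
  using assms typing_env_ConsD unfolding valid_def vars_def by blast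

lemma valid_FV: "valid M \<Gamma> \<Longrightarrow> (x, T) \<in> set \<Gamma> \<Longrightarrow> FV T \<subseteq> dom_env \<Gamma>"
proof (induction \<Gamma>)
  case (Cons a \<Gamma>)
  obtain y U where a: "a = (y, U)" by force
  obtain s where "M \<triangleright> \<Gamma> \<turnstile> U \<Colon> Sort s" "valid M \<Gamma>"
    using Cons.prems a by (auto elim: valid_ConsD)
  then show ?case
    using Cons a typing_FV[of \<Gamma> U "Sort s"] by (auto simp: dom_env_def)
qed simp

lemma valid_typing_ConsI:
  assumes "M \<triangleright> \<Gamma> \<turnstile> T \<Colon> Sort s" "vsort M x = s" "x \<notin> dom_env \<Gamma>"
  shows "valid M ((x, T) # \<Gamma>)"
proof -
  have "M \<triangleright> (x, T) # \<Gamma> \<turnstile> Var x \<Colon> T" using assms by (intro typ_var) (auto simp: vars_def)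
  then show ?thesis by (auto simp: valid_def)
qed

text \<open>(ax) speaks of the empty environment only; (weak) carries it along the
  declarations.\<close>

lemma valid_axiom: "valid M \<Gamma> \<Longrightarrow> (s1, s2) \<in> axs M \<Longrightarrow> M \<triangleright> \<Gamma> \<turnstile> Sort s1 \<Colon> Sort s2"
proof (induction \<Gamma>)
  case Nil
  then show ?case by (auto intro: typ_ax)
next
  case (Cons a \<Gamma>)
  obtain y U where a: "a = (y, U)" by force
  show ?case
    using Cons.prems(1) unfolding a
    by (rule valid_ConsD) (use Cons.IH Cons.prems in \<open>auto simp: vars_def intro: typ_weak\<close>)
qed

lemma valid_lookup: "valid M \<Gamma> \<Longrightarrow> (x, T) \<in> set \<Gamma> \<Longrightarrow> M \<triangleright> \<Gamma> \<turnstile> Var x \<Colon> T"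
proof (induction \<Gamma>)
  case (Cons a \<Gamma>)
  obtain y U where a: "a = (y, U)" by force
  show ?case
    using Cons.prems(1) unfolding a
    by (rule valid_ConsD)
      (use Cons.IH Cons.prems a in \<open>auto simp: vars_def intro: typ_weak typ_var\<close>)
qed simp

subsection \<open>Substitution lemma\<close>

text \<open>Lets the substitution lemma pass a binder with a name \<open>y\<close> outside \<Delta>.
  Neither \<open>T\<close> nor the types declared in \<Gamma> mention \<open>x\<close>, so updating
  \<theta> at \<open>x\<close> leaves their instances alone.\<close>

lemma wt_subst_extend:
  assumes \<theta>: "wt_subst M \<theta> \<Gamma> \<Delta>" and v: "valid M ((x, T) # \<Gamma>)"
    and T: "M \<triangleright> \<Delta> \<turnstile> subst \<theta> T \<Colon> Sort s" and y: "vsort M y = s" "y \<notin> dom_env \<Delta>"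
  shows "wt_subst M (\<theta>(x := Var y)) ((x, T) # \<Gamma>) ((y, subst \<theta> T) # \<Delta>)"
proof -
  have x: "x \<notin> dom_env \<Gamma>" "valid M \<Gamma>" and xT: "x \<notin> FV T"
    using v typing_FV by (blast elim: valid_ConsD)+
  have y': "y \<in> vars M s - dom_env \<Delta>" using y by (simp add: vars_def)
  have *: "subst (\<theta>(x := Var y)) S = subst \<theta> S" if "x \<notin> FV S" for S
    using that by (auto intro!: subst_cong_FV)
  have "M \<triangleright> (y, subst \<theta> T) # \<Delta> \<turnstile> (\<theta>(x := Var y)) z \<Colon> subst (\<theta>(x := Var y)) S"
    if "(z, S) \<in> set ((x, T) # \<Gamma>)" for z S
  proof (cases "(z, S) = (x, T)")
    case True
    then show ?thesis using * xT typ_var[OF T y'] by simp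
  next
    case False
    then have zS: "(z, S) \<in> set \<Gamma>" using that by auto
    then have "z \<noteq> x" "x \<notin> FV S" using x valid_FV by (force simp: dom_env_def)+
    moreover have "M \<triangleright> \<Delta> \<turnstile> \<theta> z \<Colon> subst \<theta> S" using \<theta> zS by (auto simp: wt_subst_def)
    ultimately show ?thesis using * typ_weak[OF _ T y'] by simp
  qed
  then show ?thesis
    using \<theta> v valid_typing_ConsI[OF T y]
    by (auto simp: wt_subst_def intro!: substitution_upd terms.intros simp del: list.set)
qed

lemma wt_subst_ConsD:
  assumes "wt_subst M \<theta> ((x, T) # \<Gamma>) \<Delta>"
  shows "wt_subst M \<theta> \<Gamma> \<Delta>"
  using assms by (auto simp: wt_subst_def elim: valid_ConsD)

lemma subst_subst_list:
  assumes "FV t \<subseteq> set xs" "length xs = length ts"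
  shows "subst \<theta> (subst (subst_list xs ts) t) = subst (subst_list xs (map (subst \<theta>) ts)) t"
  unfolding subst_subst using assms by (auto intro!: subst_cong_FV simp: subst_list_map subset_iff)

text \<open>The second conclusion is needed because the sort of \<open>x\<close> in a product rule is determined by the
  derivation of the environment \<open>\<Gamma>, x : T\<close>, whereas types need not be unique.\<close>

lemma typing_subst_aux:
  "M \<triangleright> \<Gamma> \<turnstile> t \<Colon> T \<Longrightarrow>
    (\<forall>\<theta> \<Delta>. wt_subst M \<theta> \<Gamma> \<Delta> \<longrightarrow> M \<triangleright> \<Delta> \<turnstile> subst \<theta> t \<Colon> subst \<theta> T) \<and>
    (\<forall>x U \<Gamma>' \<theta> \<Delta>. \<Gamma> = (x, U) # \<Gamma>' \<and> wt_subst M \<theta> \<Gamma>' \<Delta> \<longrightarrow>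
      M \<triangleright> \<Delta> \<turnstile> subst \<theta> U \<Colon> Sort (vsort M x))"
proof (induction rule: typing.induct)
  case (typ_ax s1 s2)
  then show ?case by (auto simp: wt_subst_def intro: valid_axiom)
next
  case (typ_symb f s n xTs U ts \<gamma> \<Gamma> v V)
  have "M \<triangleright> \<Delta> \<turnstile> subst \<theta> (Symb f ts) \<Colon> subst \<theta> (subst \<gamma> U)" if \<theta>: "wt_subst M \<theta> \<Gamma> \<Delta>" for \<theta> \<Delta>
  proof -
    have eq: "subst \<theta> (subst \<gamma> t) = subst (subst_list (map fst xTs) (map (subst \<theta>) ts)) t"
      if "FV t \<subseteq> fst ` set xTs" for t
      using that typ_symb by (simp add: subst_subst_list)
    have "M \<triangleright> \<Delta> \<turnstile> map (subst \<theta>) ts ! i \<Colon>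
        subst (subst_list (map fst xTs) (map (subst \<theta>) ts)) (snd (xTs ! i))" if "i < n" for i
    proof -
      have "FV (snd (xTs ! i)) \<subseteq> fst ` set xTs"
        using sym_type_FV(2)[OF typ_symb.hyps(1,2)] that typ_symb.hyps(3)
        by (metis nth_mem prod.collapse)
      then show ?thesis
        using typ_symb \<theta> that by (auto simp flip: eq)
    qed
    moreover have "M \<triangleright> \<Delta> \<turnstile> subst \<theta> v \<Colon> subst \<theta> V" using typ_symb.IH \<theta> by blast
    moreover have "length (map (subst \<theta>) ts) = n" using typ_symb.hyps by simp
    ultimately have "M \<triangleright> \<Delta> \<turnstile> Symb f (map (subst \<theta>) ts) \<Colon>
        subst (subst_list (map fst xTs) (map (subst \<theta>) ts)) U"
      using typing.typ_symb[OF typ_symb.hyps(1-3) _ refl typ_symb.hyps(6)] by blast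
    then show ?thesis
      using eq sym_type_FV(1)[OF typ_symb.hyps(1,2)] by simp
  qed
  then show ?case using typ_symb by blast
next
  case (typ_var \<Gamma> T s x)
  then show ?case by (auto simp: wt_subst_def vars_def)
next
  case (typ_weak \<Gamma> t T U s x)
  then show ?case using wt_subst_ConsD[of _ x U \<Gamma>] by (auto simp: vars_def)
next
  case (typ_prod \<Gamma> T s1 x U s2 s3)
  have "M \<triangleright> \<Delta> \<turnstile> subst \<theta> (Prod M x T U) \<Colon> Sort s3" if \<theta>: "wt_subst M \<theta> \<Gamma> \<Delta>" for \<theta> \<Delta>
  proof -
    obtain y where y: "vsort M y = vsort M x" "y \<notin> dom_env \<Delta> \<union> (\<Union>z\<in>FV U. FV (\<theta> z))"
      using fresh_var[of "dom_env \<Delta> \<union> (\<Union>z\<in>FV U. FV (\<theta> z))"] by (auto simp: dom_env_def)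
    have "wt_subst M (\<theta>(x := Var y)) ((x, T) # \<Gamma>) ((y, subst \<theta> T) # \<Delta>)"
      using typ_prod y \<theta> by (intro wt_subst_extend[where s = "vsort M x"]) (auto simp: valid_def)
    then have "M \<triangleright> (y, subst \<theta> T) # \<Delta> \<turnstile> subst (\<theta>(x := Var y)) U \<Colon> Sort s2"
      using typ_prod.IH(2) by fastforce
    moreover have "M \<triangleright> \<Delta> \<turnstile> subst \<theta> T \<Colon> Sort s1" using typ_prod.IH(1) \<theta> by fastforce
    ultimately have "M \<triangleright> \<Delta> \<turnstile> Prod M y (subst \<theta> T) (subst (\<theta>(x := Var y)) U) \<Colon> Sort s3"
      using typ_prod.hyps by (blast intro: typing.typ_prod)
    then show ?thesis using y subst_Prod_fresh[of U x y \<theta> M T] by auto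
  qed
  then show ?case using typ_prod by auto
next
  case (typ_abs x T \<Gamma> u U s)
  have "M \<triangleright> \<Delta> \<turnstile> subst \<theta> (Lam M x T u) \<Colon> subst \<theta> (Prod M x T U)" if \<theta>: "wt_subst M \<theta> \<Gamma> \<Delta>" for \<theta> \<Delta>
  proof -
    let ?A = "(\<Union>z\<in>FV U. FV (\<theta> z)) \<union> (\<Union>z\<in>FV u. FV (\<theta> z))"
    obtain y where y: "vsort M y = vsort M x" "y \<notin> dom_env \<Delta> \<union> ?A"
      using fresh_var[of "dom_env \<Delta> \<union> ?A"] by (auto simp: dom_env_def)
    have eqs: "subst \<theta> (Prod M x T U) = Prod M y (subst \<theta> T) (subst (\<theta>(x := Var y)) U)"
      "subst \<theta> (Lam M x T u) = Lam M y (subst \<theta> T) (subst (\<theta>(x := Var y)) u)"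
      using y subst_Prod_fresh[of U x y \<theta> M T] subst_Prod_fresh[of u x y \<theta> M T] by auto
    have "wt_subst M (\<theta>(x := Var y)) ((x, T) # \<Gamma>) ((y, subst \<theta> T) # \<Delta>)"
      using typ_abs y \<theta> by (intro wt_subst_extend[where s = "vsort M x"]) (auto simp: valid_def)
    then have "M \<triangleright> (y, subst \<theta> T) # \<Delta> \<turnstile> subst (\<theta>(x := Var y)) u \<Colon> subst (\<theta>(x := Var y)) U"
      using typ_abs.IH(1) by fastforce
    moreover have "M \<triangleright> \<Delta> \<turnstile> subst \<theta> (Prod M x T U) \<Colon> Sort s" using typ_abs.IH(2) \<theta> by fastforce
    ultimately show ?thesis unfolding eqs by (blast intro: typing.typ_abs)
  qed
  then show ?case using typ_abs by auto
next
  case (typ_app \<Gamma> t x U V u)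
  have "M \<triangleright> \<Delta> \<turnstile> subst \<theta> (App t u) \<Colon> subst \<theta> (V{x \<mapsto> u})" if \<theta>: "wt_subst M \<theta> \<Gamma> \<Delta>" for \<theta> \<Delta>
  proof -
    obtain y where y: "vsort M y = vsort M x" "y \<notin> (\<Union>z\<in>FV V. FV (\<theta> z)) \<union> FV V"
      using fresh_var[of "(\<Union>z\<in>FV V. FV (\<theta> z)) \<union> FV V"] by (auto simp: dom_env_def)
    let ?V = "subst (\<theta>(x := Var y)) V"
    have "M \<triangleright> \<Delta> \<turnstile> subst \<theta> t \<Colon> Prod M y (subst \<theta> U) ?V"
      using typ_app \<theta> y subst_Prod_fresh[of V x y \<theta> M U] by fastforce
    moreover have "?V \<in> terms M"
      using typ_app \<theta> by (auto simp: wt_subst_def substitution_def intro!: subst_in_terms terms.intros)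
    ultimately have "M \<triangleright> \<Delta> \<turnstile> App (subst \<theta> t) (subst \<theta> u) \<Colon> ?V{y \<mapsto> subst \<theta> u}"
      using typ_app \<theta> by (auto intro: typing.typ_app)
    moreover have "?V{y \<mapsto> subst \<theta> u} = subst \<theta> (V{x \<mapsto> u})"
    proof -
      have "subst (Var(y := subst \<theta> u)) (\<theta> z) = \<theta> z" if "z \<in> FV V" for z
        using y that by (auto intro: subst_fresh)
      then show ?thesis
        unfolding subst_subst1 unfolding subst1_def subst_subst by (auto intro!: subst_cong_FV)
    qed
    ultimately show ?thesis by simp
  qed
  then show ?case using typ_app by blast
next
  case (typ_conv \<Gamma> t T T' s')
  have "M \<triangleright> \<Delta> \<turnstile> subst \<theta> t \<Colon> subst \<theta> T'" if \<theta>: "wt_subst M \<theta> \<Gamma> \<Delta>" for \<theta> \<Delta>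
  proof -
    have "substitution M \<theta>" using \<theta> by (simp add: wt_subst_def)
    then have "conv M (subst \<theta> T) (subst \<theta> T')" using typ_conv.hyps(3) by (rule conv_subst)
    moreover have "M \<triangleright> \<Delta> \<turnstile> subst \<theta> t \<Colon> subst \<theta> T" "M \<triangleright> \<Delta> \<turnstile> subst \<theta> T' \<Colon> Sort s'"
      using typ_conv.IH \<theta> by fastforce+
    ultimately show ?thesis by (blast intro: typing.typ_conv)
  qed
  then show ?case using typ_conv.IH by blast
qed

lemma typing_subst:
  "M \<triangleright> \<Gamma> \<turnstile> t \<Colon> T \<Longrightarrow> wt_subst M \<theta> \<Gamma> \<Delta> \<Longrightarrow> M \<triangleright> \<Delta> \<turnstile> subst \<theta> t \<Colon> subst \<theta> T"
  using typing_subst_aux by blast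

text \<open>Inclusion makes the identity substitution well-typed from \<Gamma> to \<Delta>, so
  insertion at any position and exchange are instances of the substitution lemma.\<close>

lemma typing_weakening:
  assumes "M \<triangleright> \<Gamma> \<turnstile> t \<Colon> T" "valid M \<Delta>" "set \<Gamma> \<subseteq> set \<Delta>"
  shows "M \<triangleright> \<Delta> \<turnstile> t \<Colon> T"
proof -
  have "wt_subst M Var \<Gamma> \<Delta>"
    using assms by (auto simp: wt_subst_def valid_def intro: valid_lookup[unfolded valid_def])
  then show ?thesis using typing_subst[OF assms(1)] by fastforce
qed

lemma typing_subst1:
  assumes "M \<triangleright> (x, U) # \<Gamma> \<turnstile> t \<Colon> T" "M \<triangleright> \<Gamma> \<turnstile> u \<Colon> U"
  shows "M \<triangleright> \<Gamma> \<turnstile> t{x \<mapsto> u} \<Colon> T{x \<mapsto> u}"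
proof -
  have v: "valid M ((x, U) # \<Gamma>)" using assms(1) by (auto simp: valid_def)
  then have x: "x \<notin> dom_env \<Gamma>" "valid M \<Gamma>" and xU: "x \<notin> FV U"
    using typing_FV by (blast elim: valid_ConsD)+
  have "M \<triangleright> \<Gamma> \<turnstile> (Var(x := u)) z \<Colon> subst (Var(x := u)) S" if "(z, S) \<in> set ((x, U) # \<Gamma>)" for z S
  proof (cases "(z, S) = (x, U)")
    case True
    then show ?thesis using subst_fresh[of x U u] xU assms(2) by simp
  next
    case False
    then have zS: "(z, S) \<in> set \<Gamma>" using that by auto
    then have "z \<noteq> x" "x \<notin> FV S" using x valid_FV by (force simp: dom_env_def)+
    then show ?thesis using subst_fresh[of x S u] valid_lookup x(2) zS by simp
  qed
  then have "wt_subst M (Var(x := u)) ((x, U) # \<Gamma>) \<Gamma>"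
    using v x(2) typing_in_terms[OF assms(2)]
    by (auto simp: wt_subst_def intro!: substitution_upd simp del: list.set)
  then show ?thesis unfolding subst1_def using assms(1) by (rule typing_subst[rotated])
qed

lemma typing_rename:
  assumes "M \<triangleright> (x, U) # \<Gamma> \<turnstile> t \<Colon> T" "vsort M y = vsort M x" "y \<notin> dom_env \<Gamma>"
  shows "M \<triangleright> (y, U) # \<Gamma> \<turnstile> t{x \<mapsto> Var y} \<Colon> T{x \<mapsto> Var y}"
proof -
  have v: "valid M ((x, U) # \<Gamma>)" using assms(1) by (auto simp: valid_def)
  then obtain s where s: "M \<triangleright> \<Gamma> \<turnstile> U \<Colon> Sort s" "vsort M x = s" "valid M \<Gamma>"
    by (rule valid_ConsD)
  then have "wt_subst M Var \<Gamma> \<Gamma>"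
    by (auto simp: wt_subst_def intro: valid_lookup)
  then have "wt_subst M (Var(x := Var y)) ((x, U) # \<Gamma>) ((y, U) # \<Gamma>)"
    using wt_subst_extend[of Var \<Gamma> \<Gamma> x U s y] v s assms by simp
  then show ?thesis unfolding subst1_def using assms(1) by (rule typing_subst[rotated])
qed

subsection \<open>Inversion of typing\<close>

text \<open>Induction needs a subject that determines its components, hence the raw product. Its
  body is read at whatever suitable \<open>y\<close> is wanted, by renaming the premise of
  (prod).\<close>

lemma typing_RawProdD:
  assumes "M \<triangleright> \<Gamma> \<turnstile> RawProd s T B \<Colon> A" "vsort M y = s" "y \<notin> dom_env \<Gamma>"
  shows "\<exists>s1 s2. M \<triangleright> \<Gamma> \<turnstile> T \<Colon> Sort s1 \<and> M \<triangleright> (y, T) # \<Gamma> \<turnstile> open_at 0 (Var y) B \<Colon> Sort s2"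
  using assms
proof (induction \<Gamma> "RawProd s T B" A rule: typing.induct)
  case (typ_weak \<Gamma> A U s' x)
  then obtain s1 s2 where *: "M \<triangleright> \<Gamma> \<turnstile> T \<Colon> Sort s1" "M \<triangleright> (y, T) # \<Gamma> \<turnstile> open_at 0 (Var y) B \<Colon> Sort s2"
    by (auto simp: dom_env_def)
  \<comment> \<open>The sort \<open>s1\<close> found so far need not be the sort of
    \<open>y\<close>; validity of the environment yields one that is.\<close>
  then have "valid M ((y, T) # \<Gamma>)" by (auto simp: valid_def)
  then obtain s3 where s3: "M \<triangleright> \<Gamma> \<turnstile> T \<Colon> Sort s3" "vsort M y = s3"
    by (rule valid_ConsD)
  then have "valid M ((y, T) # (x, U) # \<Gamma>)"
    using typ_weak by (auto intro!: valid_typing_ConsI intro: typing.typ_weak)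
  then show ?case
    using * typ_weak typing_weakening[OF *(2), of "(y, T) # (x, U) # \<Gamma>"]
    by (auto intro: typing.typ_weak)
next
  case (typ_prod \<Gamma> T' s1 x U s2 s3)
  then have "M \<triangleright> (y, T) # \<Gamma> \<turnstile> U{x \<mapsto> Var y} \<Colon> Sort s2"
    using typing_rename[of x T \<Gamma> U "Sort s2" y] by (auto simp: Prod_def subst1_def)
  moreover have "open_at 0 (Var y) B = U{x \<mapsto> Var y}"
    using typ_prod typing_in_terms terms_lc open_at_bind_var by (metis Prod_def trm.inject(4))
  ultimately show ?case using typ_prod by (auto simp: Prod_def)
qed (auto simp: Lam_def)

lemma typing_ProdD:
  assumes "M \<triangleright> \<Gamma> \<turnstile> Prod M x T U \<Colon> A" "U \<in> terms M" "x \<notin> dom_env \<Gamma>"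
  shows "\<exists>s1 s2. M \<triangleright> \<Gamma> \<turnstile> T \<Colon> Sort s1 \<and> M \<triangleright> (x, T) # \<Gamma> \<turnstile> U \<Colon> Sort s2"
  using typing_RawProdD[OF assms(1)[unfolded Prod_def], of x] assms
  by (simp add: open_at_bind_var terms_lc subst1_def)

text \<open>Peeling off products turns the variables passed into declarations, the most recent one
  in front, whence \<open>rev\<close>.\<close>

lemma prods_typingD:
  assumes "M \<triangleright> \<Gamma> \<turnstile> prods M xTs U \<Colon> Sort s" "distinct (map fst xTs)"
    "fst ` set xTs \<inter> dom_env \<Gamma> = {}" "snd ` set xTs \<subseteq> terms M" "U \<in> terms M"
  shows "\<exists>s. M \<triangleright> rev xTs @ \<Gamma> \<turnstile> U \<Colon> Sort s" (is ?A)
    and "\<forall>i<length xTs. \<exists>s. M \<triangleright> rev (take i xTs) @ \<Gamma> \<turnstile> snd (xTs ! i) \<Colon> Sort s" (is ?B)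
proof -
  have "?A \<and> ?B" using assms
  proof (induction xTs arbitrary: \<Gamma> s)
    case (Cons a xTs)
    obtain x T where a: "a = (x, T)" by force
    obtain s1 s2 where *: "M \<triangleright> \<Gamma> \<turnstile> T \<Colon> Sort s1" "M \<triangleright> (x, T) # \<Gamma> \<turnstile> prods M xTs U \<Colon> Sort s2"
      using Cons.prems typing_ProdD[of \<Gamma> x T "prods M xTs U" "Sort s"] prods_terms[of xTs M U]
      by (auto simp: a)
    have "(\<exists>s. M \<triangleright> rev xTs @ (x, T) # \<Gamma> \<turnstile> U \<Colon> Sort s) \<and>
      (\<forall>i<length xTs. \<exists>s. M \<triangleright> rev (take i xTs) @ (x, T) # \<Gamma> \<turnstile> snd (xTs ! i) \<Colon> Sort s)"
      using Cons.IH[OF *(2)] Cons.prems by (auto simp: a dom_env_def)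
    then show ?case using *(1) by (auto simp: a less_Suc_eq_0_disj)
  qed auto
  then show ?A ?B by auto
qed

text \<open>The first \<open>i\<close> declarations of the telescope form an environment that types
  what follows, and the arguments form a well-typed substitution out of it. Only arguments before
  \<open>i\<close> need be typed, so expected types can be validated in order;
  \<open>i = length ts\<close> gives the result type.\<close>

lemma sym_type_typing:
  assumes f: "sym_type M f xTs U" "M \<triangleright> [] \<turnstile> tau M f \<Colon> Sort s" "length xTs = length ts"
    and v: "valid M \<Delta>" and ts: "set ts \<subseteq> terms M" and i: "i \<le> length ts"
    and ty: "\<forall>j<i. M \<triangleright> \<Delta> \<turnstile> ts ! j \<Colon> subst (subst_list (map fst xTs) ts) (snd (xTs ! j))"
  shows "\<exists>s. M \<triangleright> \<Delta> \<turnstile> subst (subst_list (map fst xTs) ts)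
    (if i < length ts then snd (xTs ! i) else U) \<Colon> Sort s"
proof -
  let ?\<gamma> = "subst_list (map fst xTs) ts"
  obtain s' where s': "M \<triangleright> rev (take i xTs) \<turnstile> (if i < length ts then snd (xTs ! i) else U) \<Colon> Sort s'"
    using prods_typingD[of "[]" xTs U s] f i
    by (cases "i < length ts") (auto simp: sym_type_def dom_env_def)
  have "M \<triangleright> \<Delta> \<turnstile> ?\<gamma> x \<Colon> subst ?\<gamma> T" if xT: "(x, T) \<in> set (rev (take i xTs))" for x T
  proof -
    obtain j where "j < length (take i xTs)" "take i xTs ! j = (x, T)"
      using xT by (metis in_set_conv_nth set_rev)
    then have "j < i" "xTs ! j = (x, T)" "j < length xTs" by auto
    then show ?thesis
      using f ty subst_list_nth[of "map fst xTs" ts j] by (auto simp: sym_type_def)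
  qed
  then have "wt_subst M ?\<gamma> (rev (take i xTs)) \<Delta>"
    using s' v ts unfolding wt_subst_def by (auto simp: valid_def substitution_subst_list)
  from typing_subst[OF s' this] show ?thesis by (simp only: subst.simps) blast
qed

lemma typing_codomain:
  assumes "M \<triangleright> \<Gamma> \<turnstile> Prod M x U V \<Colon> Sort s" "V \<in> terms M" "M \<triangleright> \<Gamma> \<turnstile> u \<Colon> U"
  shows "\<exists>s. M \<triangleright> \<Gamma> \<turnstile> V{x \<mapsto> u} \<Colon> Sort s"
proof -
  obtain y where y: "vsort M y = vsort M x" "y \<notin> dom_env \<Gamma> \<union> FV V"
    using fresh_var[of "dom_env \<Gamma> \<union> FV V"] by (auto simp: dom_env_def)
  then obtain s2 where "M \<triangleright> (y, U) # \<Gamma> \<turnstile> V{x \<mapsto> Var y} \<Colon> Sort s2"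
    using typing_RawProdD[OF assms(1)[unfolded Prod_def], of y] assms(2)
    by (auto simp: open_at_bind_var terms_lc)
  from typing_subst1[OF this assms(3)] y show ?thesis
    by (auto simp: subst1_rename) (auto simp: subst1_def)
qed

text \<open>By (ax) a sort can be a type without having a type itself, hence the first
  alternative.\<close>

lemma type_correctness: "M \<triangleright> \<Gamma> \<turnstile> t \<Colon> T \<Longrightarrow> (\<exists>s. T = Sort s) \<or> (\<exists>s. M \<triangleright> \<Gamma> \<turnstile> T \<Colon> Sort s)"
proof (induction rule: typing.induct)
  case (typ_symb f s n xTs U ts \<gamma> \<Gamma> v V)
  then have "set ts \<subseteq> terms M" using typing_in_terms by (fastforce simp: in_set_conv_nth)
  then show ?case
    using sym_type_typing[of f xTs U s ts \<Gamma> n] typ_symb by (auto simp: valid_def)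
next
  case (typ_app \<Gamma> t x U V u)
  then obtain s where "M \<triangleright> \<Gamma> \<turnstile> Prod M x U V \<Colon> Sort s" by (auto simp: Prod_def)
  then show ?case using typing_codomain typ_app.hyps(2,3) by blast
qed (auto intro: typing.intros)

section \<open>Chains of conversions between types that have a sort\<close>

lemma sorted_conv_env_typed:
  "(sorted_conv_env M \<Gamma>)\<^sup>*\<^sup>* T T' \<Longrightarrow> M \<triangleright> \<Gamma> \<turnstile> T \<Colon> Sort s \<Longrightarrow> \<exists>s. M \<triangleright> \<Gamma> \<turnstile> T' \<Colon> Sort s"
  by (induction rule: rtranclp_induct) (auto simp: sorted_conv_env_def conv_env_def)

lemma typing_sorted_conv:
  "(sorted_conv_env M \<Gamma>)\<^sup>*\<^sup>* T T' \<Longrightarrow> M \<triangleright> \<Gamma> \<turnstile> t \<Colon> T \<Longrightarrow> M \<triangleright> \<Gamma> \<turnstile> t \<Colon> T'"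
  by (induction rule: rtranclp_induct)
    (auto simp: sorted_conv_env_def conv_env_def intro: typ_conv)

lemma typing_sorted_conv_back:
  "(sorted_conv_env M \<Gamma>)\<^sup>*\<^sup>* T T' \<Longrightarrow> M \<triangleright> \<Gamma> \<turnstile> t \<Colon> T' \<Longrightarrow> M \<triangleright> \<Gamma> \<turnstile> t \<Colon> T"
  by (induction rule: rtranclp_induct)
    (auto simp: sorted_conv_env_def conv_env_def intro: typ_conv conv_sym)

lemma sorted_conv_env_weak:
  assumes "M \<triangleright> \<Gamma> \<turnstile> U \<Colon> Sort s" "x \<in> vars M s - dom_env \<Gamma>" "(sorted_conv_env M \<Gamma>)\<^sup>*\<^sup>* T T'"
  shows "(sorted_conv_env M ((x, U) # \<Gamma>))\<^sup>*\<^sup>* T T'"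
proof -
  have "sorted_conv_env M \<Gamma> \<le> sorted_conv_env M ((x, U) # \<Gamma>)"
    unfolding sorted_conv_env_def conv_env_def using typ_weak[OF _ assms(1,2)] by blast
  then show ?thesis using assms(3) rtranclp_mono by blast
qed

text \<open>The chain records the uses of (conv) after (abs). It starts at a product that has a
  sort, so every type on it has one.\<close>

lemma typing_RawLamD:
  assumes "M \<triangleright> \<Gamma> \<turnstile> RawLam s T B \<Colon> A" "vsort M y = s" "y \<notin> dom_env \<Gamma>"
  shows "\<exists>V s'. M \<triangleright> (y, T) # \<Gamma> \<turnstile> open_at 0 (Var y) B \<Colon> V \<and>
    M \<triangleright> \<Gamma> \<turnstile> Prod M y T V \<Colon> Sort s' \<and> (sorted_conv_env M \<Gamma>)\<^sup>*\<^sup>* (Prod M y T V) A"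
  using assms
proof (induction \<Gamma> "RawLam s T B" A rule: typing.induct)
  case (typ_weak \<Gamma> A U s' x)
  then obtain V s1 where *: "M \<triangleright> (y, T) # \<Gamma> \<turnstile> open_at 0 (Var y) B \<Colon> V"
    "M \<triangleright> \<Gamma> \<turnstile> Prod M y T V \<Colon> Sort s1" "(sorted_conv_env M \<Gamma>)\<^sup>*\<^sup>* (Prod M y T V) A"
    by (auto simp: dom_env_def)
  then have "valid M ((y, T) # \<Gamma>)" by (auto simp: valid_def)
  then obtain s3 where s3: "M \<triangleright> \<Gamma> \<turnstile> T \<Colon> Sort s3" "vsort M y = s3"
    by (rule valid_ConsD)
  then have "valid M ((y, T) # (x, U) # \<Gamma>)"
    using typ_weak by (auto intro!: valid_typing_ConsI intro: typing.typ_weak)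
  then have "M \<triangleright> (y, T) # (x, U) # \<Gamma> \<turnstile> open_at 0 (Var y) B \<Colon> V"
    using typing_weakening[OF *(1), of "(y, T) # (x, U) # \<Gamma>"] by auto
  then show ?case
    using * typ_weak by (blast intro: typing.typ_weak sorted_conv_env_weak)
next
  case (typ_abs x T' \<Gamma> u U s')
  then have [simp]: "T' = T" and B: "B = bind_var 0 x u" and s: "vsort M x = s" by (auto simp: Lam_def)
  have "M \<triangleright> (y, T) # \<Gamma> \<turnstile> u{x \<mapsto> Var y} \<Colon> U{x \<mapsto> Var y}"
    using typ_abs s by (intro typing_rename) auto
  moreover have "open_at 0 (Var y) B = u{x \<mapsto> Var y}"
    using typ_abs B typing_in_terms terms_lc open_at_bind_var by metis
  moreover have "Prod M y T (U{x \<mapsto> Var y}) = Prod M x T U"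
  proof -
    have "y \<notin> FV U - {x}" using typing_FV[OF typ_abs.hyps(1)] typ_abs.prems by (auto simp: dom_env_def)
    then show ?thesis using Prod_rename(1) typ_abs.prems s by metis
  qed
  ultimately show ?case using typ_abs.hyps(3) by (metis \<open>T' = T\<close> rtranclp.rtrancl_refl)
next
  case (typ_conv \<Gamma> A A' s')
  then obtain V s1 where *: "M \<triangleright> (y, T) # \<Gamma> \<turnstile> open_at 0 (Var y) B \<Colon> V"
    "M \<triangleright> \<Gamma> \<turnstile> Prod M y T V \<Colon> Sort s1" "(sorted_conv_env M \<Gamma>)\<^sup>*\<^sup>* (Prod M y T V) A"
    by auto
  \<comment> \<open>\<open>conv_env\<close> asks for inhabitants of both types; the abstraction
    itself inhabits them.\<close>
  moreover have "sorted_conv_env M \<Gamma> A A'"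
    using sorted_conv_env_typed[OF *(3,2)] typ_conv unfolding sorted_conv_env_def conv_env_def
    by (blast intro: typing.typ_conv)
  ultimately show ?case by (meson rtranclp.rtrancl_into_rtrancl)
qed (auto simp: Prod_def)

lemma conv_subst_list:
  "list_all2 (conv M) ts ts' \<Longrightarrow> conv M (subst_list xs ts x) (subst_list xs ts' x)"
proof (induction ts ts' arbitrary: xs rule: list_all2_induct)
  case Nil
  then show ?case by (auto simp: subst_list_def intro: conv_refl terms.intros)
next
  case (Cons t ts t' ts')
  then show ?case
    by (cases xs) (auto simp: subst_list_def intro: conv_refl terms.intros)
qed

text \<open>The domain \<open>W\<close> and codomain \<open>V'\<close> of the abstraction are only
  chained to \<open>U\<close> and \<open>V\<close>. The codomain chain given by
  \<open>logical\<close> lives under \<open>z : W\<close>, where the body is typed as well, so the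
  body gets its new type before \<open>z\<close> is replaced by \<open>u\<close>.\<close>

lemma beta_typing:
  assumes "logical M" and ty: "M \<triangleright> \<Gamma> \<turnstile> Lam M y W b \<Colon> Prod M x U V" "M \<triangleright> \<Gamma> \<turnstile> u \<Colon> U"
    and tm: "b \<in> terms M" "V \<in> terms M"
  shows "M \<triangleright> \<Gamma> \<turnstile> b{y \<mapsto> u} \<Colon> V{x \<mapsto> u}"
proof -
  obtain z where z: "vsort M z = vsort M y" "z \<notin> dom_env \<Gamma> \<union> FV V \<union> FV b"
    using fresh_var[of "dom_env \<Gamma> \<union> FV V \<union> FV b"] by (auto simp: dom_env_def)
  obtain V' s where V': "M \<triangleright> (z, W) # \<Gamma> \<turnstile> b{y \<mapsto> Var z} \<Colon> V'"
    "(sorted_conv_env M \<Gamma>)\<^sup>*\<^sup>* (Prod M z W V') (Prod M x U V)"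
    using typing_RawLamD[OF ty(1)[unfolded Lam_def], of z] z tm
    by (auto simp: open_at_bind_var terms_lc)
  have "W \<in> terms M"
    using V'(1) typing_env_ConsD typing_in_terms by blast
  then have l: "(sorted_conv_env M \<Gamma>)\<^sup>*\<^sup>* W U"
    "(sorted_conv_env M ((z, W) # \<Gamma>))\<^sup>*\<^sup>* V' (V{x \<mapsto> Var z})"
    using assms(1)[unfolded logical_def, rule_format, of W V' U V z \<Gamma> x] V' z tm
      typing_in_terms[OF ty(2)] typing_in_terms[OF V'(1)] by auto
  \<comment> \<open>The argument moves to \<open>W\<close>, so that the declaration of
    \<open>z\<close> can stay as it is.\<close>
  have "M \<triangleright> \<Gamma> \<turnstile> u \<Colon> W" using l(1) ty(2) by (rule typing_sorted_conv_back)
  from typing_subst1[OF typing_sorted_conv[OF l(2) V'(1)] this] z show ?thesis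
    by (simp add: subst1_rename)
qed

end

section \<open>Reduction steps in algebraic type systems\<close>

text \<open>Rules come with their instances, while the \<beta> schema is already closed under
  substitution.\<close>

inductive root_step :: "('s, 'v, 'f) tsm \<Rightarrow> (('s, 'v, 'f) trm \<times> ('s, 'v, 'f) trm) set
    \<Rightarrow> ('s, 'v, 'f) trm \<Rightarrow> ('s, 'v, 'f) trm \<Rightarrow> bool" for M R where
  root_rule: "(l, r) \<in> R \<Longrightarrow> substitution M \<sigma> \<Longrightarrow> root_step M R (subst \<sigma> l) (subst \<sigma> r)"
| root_beta: "U \<in> terms M \<Longrightarrow> t \<in> terms M \<Longrightarrow> u \<in> terms M \<Longrightarrow>
     root_step M R (App (Lam M x U t) u) (t{x \<mapsto> u})"

text \<open>Unlike \<open>rew_closure\<close>, this closure is under contexts only, so that its steps can be analysed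
  along the structure of terms.\<close>

inductive ctx_step :: "('s, 'v, 'f) tsm \<Rightarrow> (('s, 'v, 'f) trm \<times> ('s, 'v, 'f) trm) set
    \<Rightarrow> ('s, 'v, 'f) trm \<Rightarrow> ('s, 'v, 'f) trm \<Rightarrow> bool" for M R where
  ctx_root: "root_step M R t t' \<Longrightarrow> ctx_step M R t t'"
| ctx_prod1: "ctx_step M R t t' \<Longrightarrow> u \<in> terms M \<Longrightarrow> ctx_step M R (Prod M x t u) (Prod M x t' u)"
| ctx_prod2: "ctx_step M R t t' \<Longrightarrow> u \<in> terms M \<Longrightarrow> ctx_step M R (Prod M x u t) (Prod M x u t')"
| ctx_lam1: "ctx_step M R t t' \<Longrightarrow> u \<in> terms M \<Longrightarrow> ctx_step M R (Lam M x t u) (Lam M x t' u)"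
| ctx_lam2: "ctx_step M R t t' \<Longrightarrow> u \<in> terms M \<Longrightarrow> ctx_step M R (Lam M x u t) (Lam M x u t')"
| ctx_app1: "ctx_step M R t t' \<Longrightarrow> u \<in> terms M \<Longrightarrow> ctx_step M R (App t u) (App t' u)"
| ctx_app2: "ctx_step M R t t' \<Longrightarrow> u \<in> terms M \<Longrightarrow> ctx_step M R (App u t) (App u t')"
| ctx_symb: "ctx_step M R t t' \<Longrightarrow> f \<in> syms M s (length us + 1 + length vs) \<Longrightarrow>
     set us \<union> set vs \<subseteq> terms M \<Longrightarrow> ctx_step M R (Symb f (us @ t # vs)) (Symb f (us @ t' # vs))"

inductive env_step :: "(('s, 'v, 'f) trm \<Rightarrow> ('s, 'v, 'f) trm \<Rightarrow> bool)
    \<Rightarrow> ('s, 'v, 'f) env \<Rightarrow> ('s, 'v, 'f) env \<Rightarrow> bool" for r where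
  env_here: "r T T' \<Longrightarrow> env_step r ((x, T) # \<Gamma>) ((x, T') # \<Gamma>)"
| env_there: "env_step r \<Gamma> \<Gamma>' \<Longrightarrow> env_step r ((x, T) # \<Gamma>) ((x, T) # \<Gamma>')"

inductive_cases env_step_NilE: "env_step r [] \<Gamma>'"
inductive_cases env_step_ConsE: "env_step r ((x, T) # \<Gamma>) \<Gamma>'"

lemma env_step_dom: "env_step r \<Gamma> \<Gamma>' \<Longrightarrow> dom_env \<Gamma>' = dom_env \<Gamma>"
  by (induction rule: env_step.induct) (auto simp: dom_env_def)

lemma Lam_eq_iff_Prod_eq: "Lam M x t u = Lam M y t' u' \<longleftrightarrow> Prod M x t u = Prod M y t' u'"
  by (simp add: Lam_def Prod_def)

lemma algebraic_in_terms: "l \<in> algebraic M \<Longrightarrow> l \<in> terms M"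
  by (induction rule: algebraic.induct) (auto intro: terms.intros)

locale ats =
  fixes M :: "('s, 'v, 'f) tsm" and R :: "(('s, 'v, 'f) trm \<times> ('s, 'v, 'f) trm) set"
  assumes ATS: "ATS M R"

sublocale ats \<subseteq> pre_rts M "red M R"
  using ATS by unfold_locales (simp add: ATS_def)

context ats
begin

lemma rule_cases:
  assumes "(l, r) \<in> R"
  obtains f ls s where "l = Symb f ls" "f \<in> syms M s (length ls)" "set ls \<subseteq> terms M" "FV r \<subseteq> FV l"
proof -
  have l: "l \<in> algebraic M" "\<And>x. l \<noteq> Var x" "FV r \<subseteq> FV l"
    using ATS assms by (auto simp: ATS_def rewrite_rule_def)
  from l(1) show ?thesis
  proof cases
    case (2 f s n ls)
    then show ?thesis using l(3) that[of f ls s] algebraic_in_terms by auto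
  qed (use l(2) in auto)
qed

lemma root_step_subst:
  assumes "root_step M R t t'" "substitution M \<sigma>"
  shows "root_step M R (subst \<sigma> t) (subst \<sigma> t')"
  using assms(1)
proof cases
  case (root_rule l r \<rho>)
  then show ?thesis
    using root_step.root_rule[OF root_rule(3) substitution_comp[OF assms(2) root_rule(4)]]
    by (simp add: subst_subst)
next
  case (root_beta U b u x)
  obtain y where y: "vsort M y = vsort M x" "y \<notin> (\<Union>z\<in>FV b. FV (\<sigma> z)) \<union> FV b"
    using fresh_var[of "(\<Union>z\<in>FV b. FV (\<sigma> z)) \<union> FV b"] by auto
  let ?b = "subst (\<sigma>(x := Var y)) b"
  have "?b \<in> terms M" "subst \<sigma> U \<in> terms M" "subst \<sigma> u \<in> terms M"
    using root_beta assms(2)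
    by (auto simp: substitution_def intro!: subst_in_terms intro: terms.intros)
  then have "root_step M R (App (Lam M y (subst \<sigma> U) ?b) (subst \<sigma> u)) (?b{y \<mapsto> subst \<sigma> u})"
    by (intro root_step.root_beta)
  \<comment> \<open>\<open>y\<close> does not occur in the images involved, so contracting the redex
    commutes with \<sigma>.\<close>
  moreover have "?b{y \<mapsto> subst \<sigma> u} = subst \<sigma> (b{x \<mapsto> u})"
  proof -
    have "subst (Var(y := subst \<sigma> u)) (\<sigma> z) = \<sigma> z" if "z \<in> FV b" for z
      using y that by (auto intro: subst_fresh)
    then show ?thesis
      unfolding subst_subst1 unfolding subst1_def subst_subst by (auto intro!: subst_cong_FV)
  qed
  moreover have "subst \<sigma> (Lam M x U b) = Lam M y (subst \<sigma> U) ?b"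
    using y by (intro subst_Prod_fresh) auto
  ultimately show ?thesis using root_beta by simp
qed

text \<open>Contexts and substitutions commute once bound names are fresh, so the substitution rule
  of \<open>rew_closure\<close> can be pushed to the root and absorbed there. For a step in a body,
  \<open>y\<close> has to be fresh for both sides of the step.\<close>

lemma ctx_step_subst:
  "ctx_step M R t t' \<Longrightarrow> substitution M \<sigma> \<Longrightarrow> ctx_step M R (subst \<sigma> t) (subst \<sigma> t')"
proof (induction arbitrary: \<sigma> rule: ctx_step.induct)
  case (ctx_root t t')
  then show ?case by (auto intro: ctx_step.ctx_root root_step_subst)
next
  case (ctx_prod1 t t' u x)
  obtain y where y: "vsort M y = vsort M x" "y \<notin> (\<Union>z\<in>FV u. FV (\<sigma> z))"
    using fresh_var[of "\<Union>z\<in>FV u. FV (\<sigma> z)"] by auto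
  have \<sigma>y: "substitution M (\<sigma>(x := Var y))"
    using ctx_prod1.prems by (auto intro: substitution_upd terms.intros)
  then have "subst (\<sigma>(x := Var y)) u \<in> terms M"
    using ctx_prod1.hyps by (blast intro: substitution_in_terms)
  then have "ctx_step M R (Prod M y (subst \<sigma> t) (subst (\<sigma>(x := Var y)) u))
      (Prod M y (subst \<sigma> t') (subst (\<sigma>(x := Var y)) u))"
    using ctx_prod1 by (blast intro: ctx_step.ctx_prod1)
  then show ?case
    using y subst_Prod_fresh(1)[of u x y \<sigma> M t] subst_Prod_fresh(1)[of u x y \<sigma> M t'] by auto
next
  case (ctx_lam1 t t' u x)
  obtain y where y: "vsort M y = vsort M x" "y \<notin> (\<Union>z\<in>FV u. FV (\<sigma> z))"
    using fresh_var[of "\<Union>z\<in>FV u. FV (\<sigma> z)"] by auto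
  have \<sigma>y: "substitution M (\<sigma>(x := Var y))"
    using ctx_lam1.prems by (auto intro: substitution_upd terms.intros)
  then have "subst (\<sigma>(x := Var y)) u \<in> terms M"
    using ctx_lam1.hyps by (blast intro: substitution_in_terms)
  then have "ctx_step M R (Lam M y (subst \<sigma> t) (subst (\<sigma>(x := Var y)) u))
      (Lam M y (subst \<sigma> t') (subst (\<sigma>(x := Var y)) u))"
    using ctx_lam1 by (blast intro: ctx_step.ctx_lam1)
  then show ?case
    using y subst_Prod_fresh(2)[of u x y \<sigma> M t] subst_Prod_fresh(2)[of u x y \<sigma> M t'] by auto
next
  case (ctx_prod2 t t' u x)
  obtain y where y: "vsort M y = vsort M x" "y \<notin> (\<Union>z\<in>FV t \<union> FV t'. FV (\<sigma> z))"
    using fresh_var[of "\<Union>z\<in>FV t \<union> FV t'. FV (\<sigma> z)"] by auto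
  have "substitution M (\<sigma>(x := Var y))"
    using ctx_prod2.prems by (auto intro: substitution_upd terms.intros)
  moreover have "subst \<sigma> u \<in> terms M"
    using ctx_prod2 by (blast intro: substitution_in_terms)
  ultimately have "ctx_step M R (Prod M y (subst \<sigma> u) (subst (\<sigma>(x := Var y)) t))
      (Prod M y (subst \<sigma> u) (subst (\<sigma>(x := Var y)) t'))"
    using ctx_prod2 by (blast intro: ctx_step.ctx_prod2)
  then show ?case
    using y subst_Prod_fresh(1)[of t x y \<sigma> M u] subst_Prod_fresh(1)[of t' x y \<sigma> M u] by auto
next
  case (ctx_lam2 t t' u x)
  obtain y where y: "vsort M y = vsort M x" "y \<notin> (\<Union>z\<in>FV t \<union> FV t'. FV (\<sigma> z))"
    using fresh_var[of "\<Union>z\<in>FV t \<union> FV t'. FV (\<sigma> z)"] by auto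
  have "substitution M (\<sigma>(x := Var y))"
    using ctx_lam2.prems by (auto intro: substitution_upd terms.intros)
  moreover have "subst \<sigma> u \<in> terms M"
    using ctx_lam2 by (blast intro: substitution_in_terms)
  ultimately have "ctx_step M R (Lam M y (subst \<sigma> u) (subst (\<sigma>(x := Var y)) t))
      (Lam M y (subst \<sigma> u) (subst (\<sigma>(x := Var y)) t'))"
    using ctx_lam2 by (blast intro: ctx_step.ctx_lam2)
  then show ?case
    using y subst_Prod_fresh(2)[of t x y \<sigma> M u] subst_Prod_fresh(2)[of t' x y \<sigma> M u] by auto
next
  case (ctx_symb t t' f s us vs)
  then have "set (map (subst \<sigma>) us) \<union> set (map (subst \<sigma>) vs) \<subseteq> terms M"
    by (auto intro!: substitution_in_terms)
  then show ?case
    using ctx_symb ctx_step.ctx_symb[of M R "subst \<sigma> t" "subst \<sigma> t'" f s "map (subst \<sigma>) us" "map (subst \<sigma>) vs"]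
    by simp
qed (auto intro!: ctx_step.ctx_app1 ctx_step.ctx_app2 substitution_in_terms)

lemma red_imp_ctx_step:
  assumes "red M R t t'"
  shows "ctx_step M R t t'"
proof -
  have base: "ctx_step M R a b" if "(a, b) \<in> R \<or> beta_rule M a b" for a b
    using that
  proof
    assume "(a, b) \<in> R"
    then have "root_step M R (subst Var a) (subst Var b)" by (intro root_rule) auto
    then show ?thesis by (auto intro: ctx_root)
  next
    assume "beta_rule M a b"
    then show ?thesis by cases (auto intro: ctx_root root_beta)
  qed
  have "ctx_step M R a b" if "rew_closure M Q a b" "\<And>a b. Q a b \<Longrightarrow> ctx_step M R a b" for Q a b
    using that(1)
    by (induction rule: rew_closure.induct) (auto intro: that(2) ctx_step_subst ctx_step.intros)
  then show ?thesis using assms base unfolding red_def by blast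
qed

lemma ctx_step_imp_red: "ctx_step M R t t' \<Longrightarrow> red M R t t'"
proof (induction rule: ctx_step.induct)
  case (ctx_root t t')
  then show ?case
  proof cases
    case (root_rule l r \<sigma>)
    then show ?thesis unfolding red_def by (auto intro: rew_closure.intros)
  next
    case (root_beta U t u x)
    then show ?thesis unfolding red_def by (auto intro: rew_closure.intros beta_rule.intros)
  qed
qed (auto intro: r_ctx r_Symb)

section \<open>Inversion of a step by the shape of the term\<close>

lemma ctx_step_FV: "ctx_step M R t t' \<Longrightarrow> FV t' \<subseteq> FV t"
proof (induction rule: ctx_step.induct)
  case (ctx_root t t')
  then show ?case
  proof cases
    case (root_rule l r \<sigma>)
    then show ?thesis by (auto simp: FV_subst elim!: rule_cases)
  next
    case (root_beta U t u x)
    then show ?thesis by (auto simp: FV_subst FV_Lam subst1_def split: if_splits)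
  qed
qed (auto simp: FV_Prod FV_Lam)

lemma root_step_shape:
  assumes "root_step M R t t'"
  shows "(\<exists>f ts. t = Symb f ts) \<or> (\<exists>a b. t = App a b)"
  using assms by cases (auto elim!: rule_cases)

text \<open>A step in a body comes with its own bound name \<open>y\<close>. Since steps create no
  free variables, a name \<open>x\<close> that may replace \<open>y\<close> in \<open>u\<close> may
  do so in \<open>u'\<close>, and renaming transports the step. The equation of products also covers
  abstractions, whose equality is the same condition.\<close>

lemma ctx_step_body:
  assumes "ctx_step M R u u'" "Prod M y T u = Prod M x T' U" "U \<in> terms M"
  shows "\<exists>U'. Prod M y T u' = Prod M x T' U' \<and> Lam M y T u' = Lam M x T' U' \<and> red M R U U'"
proof (intro exI conjI)
  have u: "u \<in> terms M" using assms(1) ctx_step_imp_red r_in_terms by blast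
  have eq: "T' = T" "vsort M x = vsort M y" "x \<notin> FV u - {y}" "U = u{y \<mapsto> Var x}"
    using Prod_eq_iff[OF u assms(3)] assms(2) by auto
  then have x: "x \<notin> FV u' - {y}" using ctx_step_FV[OF assms(1)] by auto
  show "Prod M y T u' = Prod M x T' (u'{y \<mapsto> Var x})" "Lam M y T u' = Lam M x T' (u'{y \<mapsto> Var x})"
    using Prod_rename[OF x, of M T] eq by auto
  show "red M R U (u'{y \<mapsto> Var x})"
    unfolding eq(4) subst1_def using assms(1)
    by (intro r_subst ctx_step_imp_red substitution_upd) (auto intro: terms.intros)
qed

lemma red_Sort: "\<not> red M R (Sort s) t'"
proof
  assume "red M R (Sort s) t'"
  then show False
    by (cases rule: ctx_step.cases[OF red_imp_ctx_step])
      (auto dest: root_step_shape simp: Prod_def Lam_def)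
qed

lemma red_Var: "\<not> red M R (Var x) t'"
proof
  assume "red M R (Var x) t'"
  then show False
    by (cases rule: ctx_step.cases[OF red_imp_ctx_step])
      (auto dest: root_step_shape simp: Prod_def Lam_def)
qed

lemma red_ProdD:
  assumes "red M R (Prod M x T U) t'" "U \<in> terms M"
  shows "(\<exists>T'. t' = Prod M x T' U \<and> red M R T T') \<or> (\<exists>U'. t' = Prod M x T U' \<and> red M R U U')"
  using red_imp_ctx_step[OF assms(1)]
proof cases
  case ctx_root
  then show ?thesis by (auto dest: root_step_shape simp: Prod_def)
next
  case (ctx_prod1 t t1 u y)
  then show ?thesis by (auto simp: Prod_def dest: ctx_step_imp_red)
next
  case (ctx_prod2 t t1 u y)
  then show ?thesis using ctx_step_body[OF ctx_prod2(3) _ assms(2), of y u x T] by auto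
qed (auto simp: Prod_def Lam_def)

lemma red_LamD:
  assumes "red M R (Lam M x T U) t'" "U \<in> terms M"
  shows "(\<exists>T'. t' = Lam M x T' U \<and> red M R T T') \<or> (\<exists>U'. t' = Lam M x T U' \<and> red M R U U')"
  using red_imp_ctx_step[OF assms(1)]
proof cases
  case ctx_root
  then show ?thesis by (auto dest: root_step_shape simp: Lam_def)
next
  case (ctx_lam1 t t1 u y)
  then show ?thesis by (auto simp: Lam_def dest: ctx_step_imp_red)
next
  case (ctx_lam2 t t1 u y)
  then show ?thesis
    using ctx_step_body[OF ctx_lam2(3) _ assms(2), of y u x T] by (auto simp: Lam_eq_iff_Prod_eq)
qed (auto simp: Prod_def Lam_def)

lemma red_AppD:
  assumes "red M R (App t u) t'"
  shows "(\<exists>t1. t' = App t1 u \<and> red M R t t1) \<or> (\<exists>u1. t' = App t u1 \<and> red M R u u1) \<or>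
    (\<exists>x U b. t = Lam M x U b \<and> b \<in> terms M \<and> t' = b{x \<mapsto> u})"
  using red_imp_ctx_step[OF assms]
proof cases
  case ctx_root
  then show ?thesis
  proof cases
    case (root_rule l r \<sigma>)
    then show ?thesis by (auto elim!: rule_cases)
  qed blast
qed (auto simp: Prod_def Lam_def dest: ctx_step_imp_red)

lemma red_SymbD:
  assumes "red M R (Symb f ts) t'"
  shows "(\<exists>us t vs t1. ts = us @ t # vs \<and> t' = Symb f (us @ t1 # vs) \<and> red M R t t1) \<or>
    (\<exists>l r \<sigma>. (l, r) \<in> R \<and> substitution M \<sigma> \<and> Symb f ts = subst \<sigma> l \<and> t' = subst \<sigma> r)"
  using red_imp_ctx_step[OF assms]
proof cases
  case ctx_root
  then show ?thesis by cases blast+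
next
  case (ctx_symb t t1 s us vs)
  then show ?thesis using ctx_step_imp_red by blast
qed (auto simp: Prod_def Lam_def)

section \<open>Subject reduction\<close>

text \<open>Later arguments have expected types that may mention the reduced one. By (conv) it is
  enough that the new expected types are typable, which is obtained from left to right.\<close>

lemma Symb_arg_typing:
  assumes f: "f \<in> syms M s n" "sym_type M f xTs U" "length xTs = n" "length (us @ t # vs) = n"
    and tau: "M \<triangleright> [] \<turnstile> tau M f \<Colon> Sort s"
    and \<gamma>: "\<gamma> = subst_list (map fst xTs) (us @ t # vs)"
    and ty: "\<forall>i<n. M \<triangleright> \<Gamma> \<turnstile> (us @ t # vs) ! i \<Colon> subst \<gamma> (snd (xTs ! i))"
    and t': "M \<triangleright> \<Gamma> \<turnstile> t' \<Colon> subst \<gamma> (snd (xTs ! length us))" "red M R t t'"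
  shows "M \<triangleright> \<Gamma> \<turnstile> Symb f (us @ t' # vs) \<Colon> subst \<gamma> U"
proof -
  let ?ts = "us @ t # vs" and ?ts' = "us @ t' # vs"
  let ?\<gamma> = "subst_list (map fst xTs) ?ts'"
  have v: "valid M \<Gamma>" using t' by (auto simp: valid_def)
  have ts: "set ?ts \<subseteq> terms M"
  proof
    fix a assume "a \<in> set ?ts"
    then obtain i where "i < n" "?ts ! i = a" using f(4) by (metis in_set_conv_nth)
    then show "a \<in> terms M" using ty typing_in_terms by blast
  qed
  then have ts': "set ?ts' \<subseteq> terms M" using t'(2) r_in_terms by auto
  have "list_all2 (conv M) ?ts ?ts'"
    using ts conv_r[OF t'(2)] by (auto intro!: list_all2_appendI list.rel_refl_strong conv_refl)
  then have conv: "conv M (\<gamma> x) (?\<gamma> x)" for x unfolding \<gamma> by (rule conv_subst_list)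
  have ty\<gamma>: "M \<triangleright> \<Gamma> \<turnstile> ?ts' ! i \<Colon> subst \<gamma> (snd (xTs ! i))" if "i < n" for i
  proof (cases "i = length us")
    case True
    then show ?thesis using t' by simp
  next
    case False
    then have "?ts' ! i = ?ts ! i" by (auto simp: nth_append nth_Cons')
    then show ?thesis using ty that by simp
  qed
  have ty': "M \<triangleright> \<Gamma> \<turnstile> ?ts' ! i \<Colon> subst ?\<gamma> (snd (xTs ! i))" if "i < n" for i
    using that
  proof (induction i rule: less_induct)
    case (less i)
    \<comment> \<open>The arguments before \<open>i\<close> already have their new types, which
      makes the new expected type of argument \<open>i\<close> typable.\<close>
    then obtain s' where "M \<triangleright> \<Gamma> \<turnstile> subst ?\<gamma> (snd (xTs ! i)) \<Colon> Sort s'"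
      using sym_type_typing[OF f(2) tau _ v ts', of i] f by auto
    moreover have "snd (xTs ! i) \<in> terms M" using f less.prems by (auto simp: sym_type_def)
    then have "conv M (subst \<gamma> (snd (xTs ! i))) (subst ?\<gamma> (snd (xTs ! i)))"
      using conv by (rule conv_substs)
    ultimately show ?case using ty\<gamma>[OF less.prems] by (blast intro: typ_conv)
  qed
  have len: "length ?ts' = n" using f by simp
  have "M \<triangleright> \<Gamma> \<turnstile> Symb f ?ts' \<Colon> subst ?\<gamma> U"
    using typ_symb[OF f(1-3) len refl tau t'(1)] ty' by blast
  \<comment> \<open>The result type has changed too; the old one is typable because of the old
    arguments.\<close>
  moreover obtain s' where "M \<triangleright> \<Gamma> \<turnstile> subst \<gamma> U \<Colon> Sort s'"
    using sym_type_typing[OF f(2) tau _ v ts, of n] f ty \<gamma> by auto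
  moreover have "conv M (subst ?\<gamma> U) (subst \<gamma> U)"
    using f conv by (auto simp: sym_type_def intro: conv_substs conv_sym)
  ultimately show ?thesis by (rule typ_conv)
qed

text \<open>The rule is typed with its own telescope \<open>xTs'\<close> and the arguments
  \<open>ls\<close>, the derivation with \<open>xTs\<close> and \<open>ts\<close>. The two result
  types agree after \<sigma>: as \<open>tau M f\<close> is closed, \<sigma> acts on the arguments
  alone. (S5) is then used at all variables at once.\<close>

lemma rule_typing:
  assumes R: "(l, r) \<in> R" "wt_rule M R l r" "substitution M \<sigma>" "Symb f ts = subst \<sigma> l"
    and f: "f \<in> syms M s n" "sym_type M f xTs U" "length xTs = n" "length ts = n"
    and tau: "M \<triangleright> [] \<turnstile> tau M f \<Colon> Sort s"
    and \<gamma>: "\<gamma> = subst_list (map fst xTs) ts"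
    and ty: "\<forall>i<n. M \<triangleright> \<Gamma> \<turnstile> ts ! i \<Colon> subst \<gamma> (snd (xTs ! i))"
    and lhs: "M \<triangleright> \<Gamma> \<turnstile> Symb f ts \<Colon> subst \<gamma> U"
  shows "M \<triangleright> \<Gamma> \<turnstile> subst \<sigma> r \<Colon> subst \<gamma> U"
proof -
  obtain g ls xTs' U' \<Gamma>0 \<rho> where w: "l = Symb g ls" "sym_type M g xTs' U'" "length xTs' = length ls"
     "substitution M \<rho>" "M \<triangleright> \<Gamma>0 \<turnstile> r \<Colon> subst \<rho> (subst (subst_list (map fst xTs') ls) U')"
     "\<And>\<Delta> \<sigma> T. substitution M \<sigma> \<Longrightarrow> M \<triangleright> \<Delta> \<turnstile> subst \<sigma> l \<Colon> T \<Longrightarrow> wt_subst M \<sigma> \<Gamma>0 \<Delta>"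
     "\<And>\<Delta> \<sigma> T x. substitution M \<sigma> \<Longrightarrow> M \<triangleright> \<Delta> \<turnstile> subst \<sigma> l \<Colon> T \<Longrightarrow>
        joinable M (red M R) (\<sigma> x) (subst \<sigma> (\<rho> x))"
    using R(2) unfolding wt_rule_def by blast
  let ?W = "subst (subst_list (map fst xTs') ls) U'"
  have g: "g = f" "ts = map (subst \<sigma>) ls" using R(4) w(1) by auto
  have ls: "set ls \<subseteq> terms M" using R(1) w(1) by (auto elim: rule_cases)
  have ts: "set ts \<subseteq> terms M"
    using ls R(3) g by (auto intro!: substitution_in_terms)
  have "subst \<sigma> ?W = subst (subst_list (map fst xTs') ts) U'"
    unfolding g(2) using w g sym_type_FV(1)[OF f(1)] by (intro subst_subst_list) auto
  also have "\<dots> = subst \<gamma> U"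
    unfolding \<gamma> using w g f ts by (intro sym_type_subst_eq) auto
  finally have W: "subst \<sigma> ?W = subst \<gamma> U" .
  have "?W \<in> terms M"
    using w substitution_subst_list[OF ls]
    by (auto simp: sym_type_def intro!: substitution_in_terms)
  moreover have "conv M (subst \<sigma> (\<rho> x)) (\<sigma> x)" for x
  proof -
    have "conv M (\<sigma> x) (subst \<sigma> (\<rho> x))"
      using w(7)[OF R(3), of \<Gamma> "subst \<gamma> U" x] lhs R(4) by (simp add: conv_iff)
    then show ?thesis by (rule conv_sym)
  qed
  ultimately have "conv M (subst (\<lambda>x. subst \<sigma> (\<rho> x)) ?W) (subst \<sigma> ?W)" by (rule conv_substs)
  then have "conv M (subst \<sigma> (subst \<rho> ?W)) (subst \<gamma> U)" unfolding W by (simp add: subst_subst)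
  moreover have "M \<triangleright> \<Gamma> \<turnstile> subst \<sigma> r \<Colon> subst \<sigma> (subst \<rho> ?W)"
    using w(5,6) R(3,4) lhs by (auto intro: typing_subst)
  moreover obtain s' where "M \<triangleright> \<Gamma> \<turnstile> subst \<gamma> U \<Colon> Sort s'"
    using sym_type_typing[OF f(2) tau _ _ ts, of \<Gamma> n] lhs f ty \<gamma> by (auto simp: valid_def)
  ultimately show ?thesis by (blast intro: typ_conv)
qed

text \<open>Each half feeds the other: a step in a domain needs the environment half for the body,
  and a step in a declaration needs the first half for the declared type.\<close>

lemma subject_reduction_aux:
  assumes "logical M" and wt: "\<forall>(l, r)\<in>R. wt_rule M R l r"
  shows "M \<triangleright> \<Gamma> \<turnstile> t \<Colon> T \<Longrightarrow>
    (\<forall>t'. red M R t t' \<longrightarrow> M \<triangleright> \<Gamma> \<turnstile> t' \<Colon> T) \<and>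
    (\<forall>\<Gamma>'. env_step (red M R) \<Gamma> \<Gamma>' \<longrightarrow> M \<triangleright> \<Gamma>' \<turnstile> t \<Colon> T)"
proof (induction rule: typing.induct)
  case (typ_ax s1 s2)
  then show ?case by (auto simp: red_Sort elim: env_step_NilE)
next
  case (typ_symb f s n xTs U ts \<gamma> \<Gamma> v V)
  have ty: "\<forall>i<n. M \<triangleright> \<Gamma> \<turnstile> ts ! i \<Colon> subst \<gamma> (snd (xTs ! i))" using typ_symb.IH by blast
  have lhs: "M \<triangleright> \<Gamma> \<turnstile> Symb f ts \<Colon> subst \<gamma> U"
    using typ_symb.hyps ty by (intro typing.typ_symb)
  have "M \<triangleright> \<Gamma> \<turnstile> t' \<Colon> subst \<gamma> U" if "red M R (Symb f ts) t'" for t'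
    using red_SymbD[OF that]
  proof (elim disjE exE conjE)
    fix us t vs t1
    assume *: "ts = us @ t # vs" "t' = Symb f (us @ t1 # vs)" "red M R t t1"
    then have "M \<triangleright> \<Gamma> \<turnstile> t1 \<Colon> subst \<gamma> (snd (xTs ! length us))"
      using typ_symb.IH typ_symb.hyps(4) by force
    then show ?thesis
      using Symb_arg_typing[of f s n xTs U us t vs \<gamma> \<Gamma> t1] typ_symb.hyps ty * by simp
  next
    fix l r \<sigma>
    assume "(l, r) \<in> R" "substitution M \<sigma>" "Symb f ts = subst \<sigma> l" "t' = subst \<sigma> r"
    then show ?thesis
      using rule_typing[of l r \<sigma> f ts s n xTs U \<gamma> \<Gamma>] wt typ_symb.hyps ty lhs by auto
  qed
  moreover have "M \<triangleright> \<Gamma>' \<turnstile> Symb f ts \<Colon> subst \<gamma> U" if "env_step (red M R) \<Gamma> \<Gamma>'" for \<Gamma>'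
    using typ_symb.hyps(1-6) by (rule typing.typ_symb) (use typ_symb.IH that in auto)
  ultimately show ?case by blast
next
  case (typ_var \<Gamma> T s x)
  have "M \<triangleright> \<Gamma>' \<turnstile> Var x \<Colon> T" if "env_step (red M R) ((x, T) # \<Gamma>) \<Gamma>'" for \<Gamma>'
  proof -
    from that consider (here) T' where "\<Gamma>' = (x, T') # \<Gamma>" "red M R T T'"
      | (there) \<Gamma>1 where "\<Gamma>' = (x, T) # \<Gamma>1" "env_step (red M R) \<Gamma> \<Gamma>1"
      by (auto elim: env_step_ConsE)
    then show ?thesis
    proof cases
      case (here T')
      then have T': "M \<triangleright> \<Gamma> \<turnstile> T' \<Colon> Sort s" using typ_var.IH by blast
      \<comment> \<open>To convert back from \<open>T'\<close>, the old type \<open>T\<close> must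
        keep its sort under the new declaration; weakening provides it.\<close>
      have "M \<triangleright> \<Gamma>' \<turnstile> Var x \<Colon> T'" "M \<triangleright> \<Gamma>' \<turnstile> T \<Colon> Sort s"
        unfolding here(1) using T' typ_var.hyps by (auto intro: typing.typ_var typ_weak)
      moreover have "conv M T' T" using here by (blast intro: conv_r conv_sym)
      ultimately show ?thesis by (rule typ_conv)
    next
      case (there \<Gamma>1)
      then show ?thesis
        using typ_var env_step_dom[OF there(2)] by (auto intro: typing.typ_var)
    qed
  qed
  then show ?case by (auto simp: red_Var)
next
  case (typ_weak \<Gamma> t T U s x)
  have "M \<triangleright> \<Gamma>' \<turnstile> t \<Colon> T" if "env_step (red M R) ((x, U) # \<Gamma>) \<Gamma>'" for \<Gamma>'
  proof -
    from that consider (here) U' where "\<Gamma>' = (x, U') # \<Gamma>" "red M R U U'"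
      | (there) \<Gamma>1 where "\<Gamma>' = (x, U) # \<Gamma>1" "env_step (red M R) \<Gamma> \<Gamma>1"
      by (auto elim: env_step_ConsE)
    then show ?thesis
    proof cases
      case (here U')
      then show ?thesis using typ_weak by (auto intro: typing.typ_weak)
    next
      case (there \<Gamma>1)
      then show ?thesis
        using typ_weak env_step_dom[OF there(2)] by (auto intro: typing.typ_weak)
    qed
  qed
  then show ?case using typ_weak by (blast intro: typing.typ_weak)
next
  case (typ_prod \<Gamma> T s1 x U s2 s3)
  have "M \<triangleright> \<Gamma> \<turnstile> t' \<Colon> Sort s3" if "red M R (Prod M x T U) t'" for t'
    using red_ProdD[OF that typing_in_terms[OF typ_prod.hyps(2), THEN conjunct1]]
      typ_prod by (blast intro: typing.typ_prod env_here)
  then show ?case using typ_prod by (blast intro: typing.typ_prod env_there)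
next
  case (typ_abs x T \<Gamma> u U s)
  have "M \<triangleright> \<Gamma> \<turnstile> t' \<Colon> Prod M x T U" if "red M R (Lam M x T u) t'" for t'
    using red_LamD[OF that typing_in_terms[OF typ_abs.hyps(1), THEN conjunct1]]
  proof (elim disjE exE conjE)
    fix T' assume T': "t' = Lam M x T' u" "red M R T T'"
    \<comment> \<open>The product takes the same step as the abstraction, so the induction
      hypothesis for it gives the new product a sort, as (abs) requires.\<close>
    have "red M R (Prod M x T U) (Prod M x T' U)"
      using T' typing_in_terms[OF typ_abs.hyps(1)] by (auto intro: r_ctx)
    moreover from this have "M \<triangleright> \<Gamma> \<turnstile> Prod M x T' U \<Colon> Sort s" using typ_abs.IH(2) by blast
    moreover have "M \<triangleright> (x, T') # \<Gamma> \<turnstile> u \<Colon> U" using typ_abs.IH(1) T' by (blast intro: env_here)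
    ultimately show ?thesis
      unfolding T'(1) using typ_abs.hyps(2)
      by (blast intro: typing.typ_abs typ_conv conv_r conv_sym)
  next
    fix u' assume "t' = Lam M x T u'" "red M R u u'"
    then show ?thesis using typ_abs by (blast intro: typing.typ_abs)
  qed
  then show ?case using typ_abs by (blast intro: typing.typ_abs env_there)
next
  case (typ_app \<Gamma> t x U V u)
  have "M \<triangleright> \<Gamma> \<turnstile> t' \<Colon> V{x \<mapsto> u}" if "red M R (App t u) t'" for t'
    using red_AppD[OF that]
  proof (elim disjE exE conjE)
    fix t1 assume "t' = App t1 u" "red M R t t1"
    then show ?thesis using typ_app by (blast intro: typing.typ_app)
  next
    fix u1 assume u1: "t' = App t u1" "red M R u u1"
    then have "M \<triangleright> \<Gamma> \<turnstile> t' \<Colon> V{x \<mapsto> u1}" using typ_app by (blast intro: typing.typ_app)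
    moreover have "conv M (V{x \<mapsto> u1}) (V{x \<mapsto> u})"
      using u1 typ_app.hyps by (blast intro: conv_subst1 conv_sym conv_r)
    \<comment> \<open>A product is no sort, so the type of \<open>t\<close> has a sort; its codomain
      at \<open>u\<close> then has one, as (conv) needs.\<close>
    moreover obtain s where "M \<triangleright> \<Gamma> \<turnstile> Prod M x U V \<Colon> Sort s"
      using type_correctness[OF typ_app.hyps(1)] by (auto simp: Prod_def)
    ultimately show ?thesis
      using typing_codomain typ_app.hyps(2,3) by (blast intro: typ_conv)
  next
    fix y W b assume "t = Lam M y W b" "b \<in> terms M" "t' = b{y \<mapsto> u}"
    then show ?thesis using typ_app.hyps assms(1) by (blast intro: beta_typing)
  qed
  then show ?case using typ_app by (blast intro: typing.typ_app)
next
  case (typ_conv \<Gamma> t T T' s')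
  then show ?case by (blast intro: typing.typ_conv)
qed

end

theorem mainTheorem1:
  fixes M :: "('s, 'v, 'f) tsm" and R :: "(('s, 'v, 'f) trm \<times> ('s, 'v, 'f) trm) set"
  assumes "ATS M R"
    and "logical M"
    and "\<forall>(l, r)\<in>R. wt_rule M R l r"
  shows "RTS M (red M R)"
proof -
  interpret ats M R using assms(1) by unfold_locales
  show ?thesis
    using pre_RTS subject_reduction_aux[OF assms(2,3)] unfolding RTS_def by blast
qed

end
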